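(* For every $n\ge 1$, the set $\mathcal A_n$ of self-complementary (equivalently, achiral) rotation classes of noncrossing partitions of $[n]$ is equinumerous with the set of self-complementary noncrossing partitions of $[n]$, and hence $|\mathcal A_n|=\binom{n}{\lfloor n/2\rfloor}$.
   Context: Write $[n]=\{1,2,\dots,n\}$. A partition of $[n]$ is noncrossing if no quadruple $a<b<c<d$ has $a,c$ in one block and $b,d$ in a different block. The rotation operator $R$ on partitions of $[n]$ is induced by the map $i\mapsto i+1\pmod n$ on $[n]$. The rotation class of $\pi$ is $A(\pi)=\{R^i(\pi): i\ge 1\}$. The complement $C(\pi)$ of a partition $\pi$ of $[n]$ is obtained by replacing every element $i$ by $n+1-i$. Both $R$ and $C$ preserve the noncrossing property, and $C\circ R=R^{-1}\circ C$, so $C$ permutes rotation classes. A partition $\pi$ is self-complementary if $C(\pi)=\pi$; a rotation class $A$ is self-complementary (also called achiral) if $C(A)=A$ as a set of partitions. A self-complementary rotation class need not contain any self-complementary partition. *)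

theory Defs
  imports Complex_Main "HOL-Library.Disjoint_Sets" "HOL-Library.Equipollence"
begin

definition crossing :: "nat set set \<Rightarrow> bool" where
  "crossing P \<longleftrightarrow>
     (\<exists>A\<in>P. \<exists>B\<in>P. A \<noteq> B \<and>
        (\<exists>a b c d. a < b \<and> b < c \<and> c < d \<and> a \<in> A \<and> c \<in> A \<and> b \<in> B \<and> d \<in> B))"

definition NC :: "nat \<Rightarrow> nat set set set" where
  "NC n = {P. partition_on {1..n} P \<and> \<not> crossing P}"

(* On {1..n} the map i \<mapsto> i mod n + 1 sends i to i + 1 for i < n, and n to 1. *)
definition rotation :: "nat \<Rightarrow> nat set set \<Rightarrow> nat set set" where
  "rotation n P = (\<lambda>B. (\<lambda>i. i mod n + 1) ` B) ` P"

definition complement :: "nat \<Rightarrow> nat set set \<Rightarrow> nat set set" where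
  "complement n P = (\<lambda>B. (\<lambda>i. n + 1 - i) ` B) ` P"

definition rotation_class :: "nat \<Rightarrow> nat set set \<Rightarrow> nat set set set" where
  "rotation_class n P = {(rotation n ^^ i) P | i. i \<ge> 1}"

definition self_complementary_NC :: "nat \<Rightarrow> nat set set set" where
  "self_complementary_NC n = {P \<in> NC n. complement n P = P}"

definition NC_rotation_classes :: "nat \<Rightarrow> nat set set set set" where
  "NC_rotation_classes n = rotation_class n ` NC n"

(* The class is only required to be mapped onto itself; its members need not be
   fixed individually. *)
definition achiral_NC_classes :: "nat \<Rightarrow> nat set set set set" where
  "achiral_NC_classes n = {A \<in> NC_rotation_classes n. complement n ` A = A}"

end

(* Let R be the rotation and C the complement. Every reflection of a rotation class of period m is
   the index map i |-> k - i modulo m for some k. In an achiral class, C and C o R together therefore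
   fix as many partitions as there are j < 2m with j = k (mod m), namely two, and so
   2 |A_n| = |Fix C| + |Fix (C o R)|.

   A partition fixed by C is determined by its restriction to the left half together with the set
   of blocks that continue into the right half; this can be any set of outer blocks (blocks not
   nested under another one), containing the block of the middle point if n is odd. Hence |Fix C|
   reduces to the sum of 2^(number of outer blocks) over the noncrossing partitions of [k], which is
   the central binomial coefficient: the largest point is either a singleton or joins an outer block,
   and then hides all outer blocks to the right of it.

   For odd n, C o R is conjugate to C by a power of R. For even n, a partition fixed by C o R arises
   from a partition of [n - 1] fixed by C by adding n as a singleton or to the unique
   self-complementary outer block, so |Fix (C o R)| = 2 binom(n - 1, n/2 - 1) = binom(n, n/2). *)

theory Submission
  imports Defs
begin

section \<open>Adding a largest point\<close>

text \<open>Taking \<open>B = {}\<close> adds \<open>x\<close> as a singleton block, so one formula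
  covers both ways in which a new point can enter a partition.\<close>

definition ins :: "'a \<Rightarrow> 'a set \<Rightarrow> 'a set set \<Rightarrow> 'a set set" where
  "ins x B P = insert (insert x B) (P - {B})"

text \<open>These are the blocks not nested under another block; they stay visible from a new point
  placed to the right of everything.\<close>

definition outer :: "nat set set \<Rightarrow> nat set set" where
  "outer P = {B \<in> P. \<forall>A\<in>P. \<forall>a\<in>A. \<forall>c\<in>A. \<forall>b\<in>B. a < b \<and> b < c \<longrightarrow> A = B}"

lemma partition_on_blocks_eq:
  assumes "partition_on X P" "A \<in> P" "B \<in> P" "x \<in> A" "x \<in> B"
  shows "A = B"
  using assms by (meson disjnt_iff pairwiseD partition_on_def disjointD disjoint_iff)

lemma crossingI:
  assumes "A \<in> P" "B \<in> P" "A \<noteq> B" "a < b" "b < c" "c < d" "a \<in> A" "c \<in> A" "b \<in> B" "d \<in> B"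
  shows "crossing P"
  using assms unfolding crossing_def by (intro bexI[of _ A] bexI[of _ B] conjI exI) (rule assms)+

lemma crossingE:
  assumes "crossing P"
  obtains A B a b c d where "A \<in> P" "B \<in> P" "A \<noteq> B"
    "a < b" "b < c" "c < d" "a \<in> A" "c \<in> A" "b \<in> B" "d \<in> B"
  using assms unfolding crossing_def by blast

lemma outerD:
  assumes "B \<in> outer P" "A \<in> P" "a \<in> A" "c \<in> A" "b \<in> B" "a < b" "b < c"
  shows "A = B"
  using assms unfolding outer_def by auto

lemma partition_on_ins:
  assumes P: "partition_on X P" and x: "x \<notin> X" and B: "B \<in> insert {} P"
  shows "partition_on (insert x X) (ins x B P)"
proof -
  have cov: "\<Union>P = X" and ne: "{} \<notin> P" using P by (auto simp: partition_on_def)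
  have eq: "\<And>A B y. A \<in> P \<Longrightarrow> B \<in> P \<Longrightarrow> y \<in> A \<Longrightarrow> y \<in> B \<Longrightarrow> A = B"
    using partition_on_blocks_eq[OF P] by blast
  show ?thesis
  proof (rule partition_onI)
    show "\<Union>(ins x B P) = insert x X" using cov B by (auto simp: ins_def)
    show "disjnt p q" if "p \<in> ins x B P" "q \<in> ins x B P" "p \<noteq> q" for p q
      using that eq B cov x unfolding ins_def disjnt_iff by (auto 5 3)
    show "{} \<notin> ins x B P" using ne by (auto simp: ins_def)
  qed
qed

text \<open>Left inverse of \<open>ins\<close>; the difference with \<open>{{}}\<close> discards the
  block that becomes empty when \<open>x\<close> was a singleton.\<close>

lemma ins_del:
  assumes P: "partition_on X P" and x: "x \<notin> X" and B: "B \<in> insert {} P"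
  shows "(\<lambda>A. A - {x}) ` ins x B P - {{}} = P"
proof -
  have nx: "\<And>A. A \<in> P \<Longrightarrow> x \<notin> A" and ne: "{} \<notin> P" 
    using P x by (auto simp: partition_on_def)
  have "(\<lambda>A. A - {x}) ` (P - {B}) = P - {B}" using nx by force
  moreover have "insert x B - {x} = B" using nx B by auto
  ultimately show ?thesis using ne B by (auto simp: ins_def)
qed

lemma ins_inject:
  assumes P: "partition_on X P" and P': "partition_on X P'" and x: "x \<notin> X"
    and B: "B \<in> insert {} P" and B': "B' \<in> insert {} P'" and eq: "ins x B P = ins x B' P'"
  shows "P = P'" "B = B'"
proof -
  show "P = P'" using ins_del[OF P x B] ins_del[OF P' x B'] eq by simp
  have "insert x B = insert x B'"
    by (rule partition_on_blocks_eq[OF partition_on_ins[OF P x B], of _ _ x])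
       (use eq in \<open>auto simp: ins_def\<close>)
  moreover have "x \<notin> B" "x \<notin> B'" using P P' x B B' by (auto simp: partition_on_def)
  ultimately show "B = B'" by (metis Diff_insert_absorb)
qed

text \<open>The witnesses are \<open>P\<close> with \<open>x\<close> deleted and the block of
  \<open>x\<close> without \<open>x\<close>, which is empty if \<open>x\<close> is a
  singleton.\<close>

lemma ins_exhaust:
  assumes P: "partition_on (insert x X) P" and x: "x \<notin> X"
  obtains Q B where "partition_on X Q" "B \<in> insert {} Q" "P = ins x B Q"
proof -
  have cov: "\<Union>P = insert x X" and ne: "{} \<notin> P" using P by (auto simp: partition_on_def)
  have eq: "\<And>A B y. A \<in> P \<Longrightarrow> B \<in> P \<Longrightarrow> y \<in> A \<Longrightarrow> y \<in> B \<Longrightarrow> A = B"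
    using partition_on_blocks_eq[OF P] by blast
  obtain D where D: "D \<in> P" "x \<in> D" using cov by blast
  define B where "B = D - {x}"
  define Q where "Q = insert B (P - {D}) - {{}}"
  have DB: "D = insert x B" using D by (auto simp: B_def)
  have "partition_on X Q"
  proof (rule partition_onI)
    show "\<Union>Q = X"
    proof -
      have "\<Union>Q = \<Union>(insert B (P - {D}))" by (auto simp: Q_def)
      also have "\<dots> = \<Union>P - {x}"
      proof -
        have "x \<notin> \<Union>(P - {D})" using D eq by auto
        moreover have "\<Union>P = D \<union> \<Union>(P - {D})" using D by blast
        ultimately show ?thesis by (auto simp: B_def)
      qed
      finally show ?thesis using cov x by auto
    qed
    show "disjnt p q" if "p \<in> Q" "q \<in> Q" "p \<noteq> q" for p q
      using that eq D unfolding Q_def B_def disjnt_iff by blast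
    show "{} \<notin> Q" by (auto simp: Q_def)
  qed
  moreover have "B \<in> insert {} Q" by (auto simp: Q_def)
  moreover have "P = ins x B Q"
  proof -
    \<comment> \<open>Otherwise \<open>B\<close> would be a nonempty block inside \<open>D\<close>,
      hence equal to \<open>D\<close>, although it lacks \<open>x\<close>. Thus removing
      \<open>B\<close> from \<open>Q\<close> leaves exactly the blocks of \<open>P\<close> other
      than \<open>D\<close>.\<close>
    have "B \<notin> P"
    proof
      assume "B \<in> P"
      moreover obtain y where "y \<in> B" using \<open>B \<in> P\<close> ne by fastforce
      ultimately show False using eq[of B D y] D by (auto simp: B_def)
    qed
    then have "Q - {B} = P - {D}" using ne by (auto simp: Q_def)
    then show ?thesis using D DB by (auto simp: ins_def)
  qed
  ultimately show ?thesis using that by blast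
qed

text \<open>The largest point \<open>x\<close> can only be the last of four crossing points. It then
  completes a crossing exactly when some point of \<open>B\<close> lies under an arc of another
  block, which is what being outer excludes.\<close>

lemma crossing_ins_iff:
  assumes P: "partition_on X P" and x: "\<And>y. y \<in> X \<Longrightarrow> y < x" and B: "B \<in> insert {} P"
  shows "crossing (ins x B P) \<longleftrightarrow> crossing P \<or> (B \<noteq> {} \<and> B \<notin> outer P)"
proof -
  have lt: "\<And>A y. A \<in> P \<Longrightarrow> y \<in> A \<Longrightarrow> y < x" using P x by (auto simp: partition_on_def)
  have eq: "\<And>A B y. A \<in> P \<Longrightarrow> B \<in> P \<Longrightarrow> y \<in> A \<Longrightarrow> y \<in> B \<Longrightarrow> A = B"
    using partition_on_blocks_eq[OF P] by blast
  show ?thesis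
  proof
    assume "crossing (ins x B P)"
    then obtain C D a b c d where *: "C \<in> ins x B P" "D \<in> ins x B P" "C \<noteq> D"
      "a < b" "b < c" "c < d" "a \<in> C" "c \<in> C" "b \<in> D" "d \<in> D"
      by (rule crossingE)
    have le: "\<And>A y. A \<in> ins x B P \<Longrightarrow> y \<in> A \<Longrightarrow> y \<le> x"
      using lt B by (fastforce simp: ins_def)
    have "d \<le> x" using le * by blast
    then have abc: "a < x" "b < x" "c < x" using * by linarith+
    define C' where "C' = (if C = insert x B then B else C)"
    define D' where "D' = (if D = insert x B then B else D)"
    have C': "C' \<in> P" "a \<in> C'" "c \<in> C'"
      using * abc B by (auto simp: C'_def ins_def split: if_splits)
    have D': "D' \<in> P" "b \<in> D'"
      using * abc B by (auto simp: D'_def ins_def split: if_splits)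
    have ne: "C' \<noteq> D'"
      using * C' D' by (auto simp: C'_def D'_def ins_def split: if_splits)
    show "crossing P \<or> (B \<noteq> {} \<and> B \<notin> outer P)"
    proof (cases "d = x")
      case True
      then have "D' = B" using * lt by (auto simp: D'_def ins_def)
      then show ?thesis
        using C' D' ne * unfolding outer_def by blast
    next
      case False
      then have "d \<in> D'" using * by (auto simp: D'_def ins_def)
      then show ?thesis using crossingI[of C' P D' a b c d] C' D' ne * by auto
    qed
  next
    assume "crossing P \<or> (B \<noteq> {} \<and> B \<notin> outer P)"
    then show "crossing (ins x B P)"
    proof
      assume "crossing P"
      then obtain C D a b c d where *: "C \<in> P" "D \<in> P" "C \<noteq> D"
        "a < b" "b < c" "c < d" "a \<in> C" "c \<in> C" "b \<in> D" "d \<in> D"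
        by (rule crossingE)
      define C' where "C' = (if C = B then insert x B else C)"
      define D' where "D' = (if D = B then insert x B else D)"
      have "C' \<in> ins x B P" "D' \<in> ins x B P" "a \<in> C'" "c \<in> C'" "b \<in> D'" "d \<in> D'"
        using * by (auto simp: C'_def D'_def ins_def)
      moreover have "C' \<noteq> D'"
        using * lt by (auto simp: C'_def D'_def)
      ultimately show ?thesis using crossingI[of C' _ D' a b c d] * by auto
    next
      assume h: "B \<noteq> {} \<and> B \<notin> outer P"
      then obtain A a b c where *: "A \<in> P" "a \<in> A" "c \<in> A" "b \<in> B" "a < b" "b < c" "A \<noteq> B"
        using B unfolding outer_def by blast
      have "A \<noteq> insert x B" using lt * by blast
      moreover have "A \<in> ins x B P" "insert x B \<in> ins x B P" "c < x"
        using * lt by (auto simp: ins_def)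
      ultimately show ?thesis using * crossingI[of A _ "insert x B" a b c x] by auto
    qed
  qed
qed

text \<open>The new block ends at the largest point and contains no covered point of
  \<open>B\<close>, so it is outer. Its arc from \<open>Max B\<close> to \<open>x\<close> hides
  every block whose maximum lies beyond \<open>Max B\<close>; no other outer block becomes covered,
  and a singleton covers none.\<close>

lemma outer_ins:
  assumes P: "partition_on X P" and x: "\<And>y. y \<in> X \<Longrightarrow> y < x" and B: "B = {} \<or> B \<in> outer P"
    and fin: "finite X"
  shows "outer (ins x B P) = insert (insert x B) {A \<in> outer P. B = {} \<or> Max A < Max B}"
proof -
  have lt: "\<And>A y. A \<in> P \<Longrightarrow> y \<in> A \<Longrightarrow> y < x" using P x by (auto simp: partition_on_def)
  have fA: "\<And>A. A \<in> P \<Longrightarrow> finite A \<and> A \<noteq> {}"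
    using P fin by (auto simp: partition_on_def intro: finite_subset)
  have eq: "\<And>A B y. A \<in> P \<Longrightarrow> B \<in> P \<Longrightarrow> y \<in> A \<Longrightarrow> y \<in> B \<Longrightarrow> A = B"
    using partition_on_blocks_eq[OF P] by blast
  have oP: "outer P \<subseteq> P" by (auto simp: outer_def)
  have le: "\<And>A y. A \<in> ins x B P \<Longrightarrow> y \<in> A \<Longrightarrow> y \<le> x"
    using lt B oP by (fastforce simp: ins_def)
  have x_in: "\<And>A. A \<in> ins x B P \<Longrightarrow> x \<in> A \<Longrightarrow> A = insert x B" using lt by (auto simp: ins_def)
  show ?thesis
  proof (intro equalityI subsetI)
    fix A assume A: "A \<in> outer (ins x B P)"
    show "A \<in> insert (insert x B) {A \<in> outer P. B = {} \<or> Max A < Max B}"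
    proof (cases "A = insert x B")
      case False
      then have AP: "A \<in> P" "A \<noteq> B" using A by (auto simp: outer_def ins_def)
      have cv: "\<And>D a b c. D \<in> ins x B P \<Longrightarrow> a \<in> D \<Longrightarrow> c \<in> D \<Longrightarrow> b \<in> A \<Longrightarrow> a < b \<Longrightarrow> b < c \<Longrightarrow> D = A"
        using A unfolding outer_def by blast
      have "A \<in> outer P"
        unfolding outer_def
      proof (safe; (rule AP)?)
        fix D a b c assume h: "D \<in> P" "a \<in> D" "c \<in> D" "b \<in> A" "a < b" "b < c"
        have "D \<noteq> B \<Longrightarrow> D = A" using cv[of D a c b] h by (auto simp: ins_def)
        moreover have "D = B \<Longrightarrow> insert x B = A" using cv[of "insert x B" a c b] h by (auto simp: ins_def)
        ultimately have "D = A" using False by blast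
        then show "z \<in> A" if "z \<in> D" for z using that by simp
        show "z \<in> D" if "z \<in> A" for z using that \<open>D = A\<close> by simp
      qed
      moreover have "Max A < Max B" if "B \<noteq> {}"
      proof (rule ccontr)
        assume "\<not> Max A < Max B"
        moreover have BP: "B \<in> P" using B that oP by auto
        ultimately have "Max B < Max A" using eq fA AP by (metis Max_in linorder_neqE_nat)
        then have "insert x B = A" using cv[of "insert x B" "Max B" x "Max A"] fA AP BP lt that
          by (auto simp: ins_def)
        then show False using False by simp
      qed
      ultimately show ?thesis by blast
    qed simp
  next
    fix A assume A: "A \<in> insert (insert x B) {A \<in> outer P. B = {} \<or> Max A < Max B}"
    show "A \<in> outer (ins x B P)"
    proof (cases "A = insert x B")
      case True
      have "D = A" if h: "D \<in> ins x B P" "a \<in> D" "c \<in> D" "b \<in> A" "a < b" "b < c" for D a b c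
      proof (rule ccontr)
        assume ne: "D \<noteq> A"
        then have D: "D \<in> P" "D \<noteq> B" using h True by (auto simp: ins_def)
        have "b \<noteq> x" using le[of D c] h by auto
        then have b: "b \<in> B" using h True by auto
        then have "B \<in> outer P" using B by auto
        then have "D = B" using D h b unfolding outer_def by blast
        then show False using D by simp
      qed
      then show ?thesis unfolding outer_def True by (auto simp: ins_def)
    next
      case False
      then have AP: "A \<in> outer P" "A \<in> P" and M: "B = {} \<or> Max A < Max B" using A oP by auto
      have AB: "A \<noteq> B" using M AP fA by auto
      have Ai: "A \<in> ins x B P" using AP AB by (auto simp: ins_def)
      have "D = A" if h: "D \<in> ins x B P" "a \<in> D" "c \<in> D" "b \<in> A" "a < b" "b < c" for D a b c
      proof (cases "D = insert x B")
        case True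
        \<comment> \<open>An arc of the new block that covers \<open>b\<close> can be shortened to
          end at \<open>Max B\<close>, because \<open>b\<close> lies to the left of
          \<open>Max B\<close>; then \<open>B\<close> itself already covers a point of
          \<open>A\<close>.\<close>
        have bx: "b < x" using lt AP h by auto
        then have aB: "a \<in> B" using True h by auto
        then have BP: "B \<in> P" "B \<noteq> {}" using B oP by auto
        have "b \<le> Max A" using h AP fA by auto
        also have "\<dots> < Max B" using M BP by simp
        finally have "b < Max B" .
        moreover have "Max B \<in> B" using BP fA by auto
        ultimately have "B = A" using AP(1) BP aB h unfolding outer_def by blast
        then show ?thesis using AB by simp
      next
        case False
        then have "D \<in> P" using h by (auto simp: ins_def)
        then show ?thesis using AP(1) h unfolding outer_def by blast
      qed
      then show ?thesis using Ai unfolding outer_def by blast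
    qed
  qed
qed

text \<open>By \<open>crossing_ins_iff\<close> the outer blocks are exactly the nonempty choices of
  \<open>B\<close> that create no crossing; \<open>ins_exhaust\<close> and \<open>ins_inject\<close>
  ensure that each partition arises once.\<close>

lemma NC_Suc_bij:
  "bij_betw (\<lambda>(P, B). ins (Suc m) B P) (SIGMA P:NC m. insert {} (outer P)) (NC (Suc m))"
proof -
  have X: "{1..Suc m} = insert (Suc m) {1..m}" by auto
  have nin: "Suc m \<notin> {1..m}" by simp
  have lt: "\<And>y. y \<in> {1..m} \<Longrightarrow> y < Suc m" by simp
  have oP: "\<And>P. outer P \<subseteq> P" by (auto simp: outer_def)
  have "inj_on (\<lambda>(P, B). ins (Suc m) B P) (SIGMA P:NC m. insert {} (outer P))"
  proof (rule inj_onI, clarsimp split del: if_split)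
    fix P B P' B'
    assume h: "P \<in> NC m" "P' \<in> NC m" "B = {} \<or> B \<in> outer P" "B' = {} \<or> B' \<in> outer P'"
      "ins (Suc m) B P = ins (Suc m) B' P'"
    have "partition_on {1..m} P" "partition_on {1..m} P'" using h by (auto simp: NC_def)
    moreover have "B \<in> insert {} P" "B' \<in> insert {} P'" using h oP by auto
    ultimately show "P = P' \<and> B = B'" using ins_inject[of "{1..m}" P P' "Suc m" B B'] h by auto
  qed
  moreover have "(\<lambda>(P, B). ins (Suc m) B P) ` (SIGMA P:NC m. insert {} (outer P)) = NC (Suc m)"
  proof (intro equalityI subsetI)
    fix Q assume "Q \<in> (\<lambda>(P, B). ins (Suc m) B P) ` (SIGMA P:NC m. insert {} (outer P))"
    then obtain P B where h: "P \<in> NC m" "B \<in> insert {} (outer P)" "Q = ins (Suc m) B P" by auto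
    have P: "partition_on {1..m} P" "\<not> crossing P" using h by (auto simp: NC_def)
    have B: "B \<in> insert {} P" using h oP by auto
    show "Q \<in> NC (Suc m)"
      using partition_on_ins[OF P(1) nin B] crossing_ins_iff[OF P(1) lt B] P h
      unfolding NC_def X by auto
  next
    fix Q assume "Q \<in> NC (Suc m)"
    then have Q: "partition_on (insert (Suc m) {1..m}) Q" "\<not> crossing Q" unfolding NC_def X by auto
    obtain P B where P: "partition_on {1..m} P" and B: "B \<in> insert {} P" and Qe: "Q = ins (Suc m) B P"
      using ins_exhaust[OF Q(1) nin] by blast
    have "P \<in> NC m" "B \<in> insert {} (outer P)"
      using crossing_ins_iff[OF P lt B] Q P B Qe by (auto simp: NC_def)
    then show "Q \<in> (\<lambda>(P, B). ins (Suc m) B P) ` (SIGMA P:NC m. insert {} (outer P))"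
      using Qe by force
  qed
  ultimately show ?thesis by (simp add: bij_betw_def)
qed

section \<open>Noncrossing partitions weighted by their number of outer blocks\<close>

lemma finite_NC: "finite (NC n)"
  by (rule finite_subset[of _ "Pow (Pow {1..n})"]) (auto simp: NC_def partition_on_def)

lemma NC_block: "P \<in> NC m \<Longrightarrow> A \<in> P \<Longrightarrow> finite A \<and> A \<noteq> {} \<and> A \<subseteq> {1..m}"
  unfolding NC_def partition_on_def by (metis (mono_tags, lifting) Union_upper finite_atLeastAtMost finite_subset mem_Collect_eq)

lemma finite_NC_member: "P \<in> NC m \<Longrightarrow> finite P"
  by (rule finite_subset[of _ "Pow {1..m}"]) (use NC_block in blast, simp)

text \<open>The ranks under an injective \<open>g\<close> run through 0, ...,
  \<open>card S - 1\<close> once each; the induction removes the element of largest value, which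
  does not affect the other ranks.\<close>

lemma sum_rank:
  fixes g :: "'a \<Rightarrow> 'b::linorder"
  assumes "finite S" "inj_on g S"
  shows "(\<Sum>B\<in>S. f (card {A \<in> S. g A < g B})) = (\<Sum>j<card S. f j)"
  using assms
proof (induction "card S" arbitrary: S)
  case (Suc k)
  then have "S \<noteq> {}" by auto
  define M where "M = Max (g ` S)"
  have "M \<in> g ` S" unfolding M_def using Suc \<open>S \<noteq> {}\<close> by (intro Max_in) auto
  then obtain b where b: "b \<in> S" "g b = M" by auto
  have mx: "g a < g b" if "a \<in> S" "a \<noteq> b" for a
  proof -
    have "g a \<le> M" unfolding M_def using Suc that by auto
    moreover have "g a \<noteq> g b" using Suc.prems that b by (auto dest: inj_onD)
    ultimately show ?thesis using b by auto
  qed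
  define T where "T = S - {b}"
  have ST: "S = insert b T" "b \<notin> T" "finite T" using b Suc by (auto simp: T_def)
  have cT: "k = card T" using Suc ST by auto
  have "{A \<in> S. g A < g b} = T" using mx unfolding T_def by auto
  moreover have "{A \<in> S. g A < g B} = {A \<in> T. g A < g B}" if "B \<in> T" for B
    using mx[of B] that unfolding T_def by force
  moreover have "(\<Sum>B\<in>T. f (card {A \<in> T. g A < g B})) = (\<Sum>j<card T. f j)"
    using Suc.hyps(1)[OF cT] ST inj_on_subset[OF Suc.prems(2), of T] by blast
  ultimately show ?case using ST Suc.hyps(2) cT by (simp add: add.commute)
qed simp

text \<open>A partition with \<open>i\<close> outer blocks has one extension with each of 1, ...,
  \<open>i + 1\<close> outer blocks: joining the block of rank \<open>j\<close> (counted from 0, by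
  maximum) leaves \<open>j\<close> older outer blocks besides the new one, and a singleton hides
  none.\<close>

lemma sum_NC_Suc:
  fixes f :: "nat \<Rightarrow> nat"
  shows "(\<Sum>P\<in>NC (Suc m). f (card (outer P))) = (\<Sum>P\<in>NC m. \<Sum>j\<le>card (outer P). f (Suc j))"
proof -
  have "(\<Sum>P\<in>NC (Suc m). f (card (outer P)))
      = (\<Sum>(P, B)\<in>(SIGMA P:NC m. insert {} (outer P)). f (card (outer (ins (Suc m) B P))))"
    using sum.reindex_bij_betw[OF NC_Suc_bij, of "\<lambda>P. f (card (outer P))" m]
    by (simp add: case_prod_unfold)
  also have "\<dots> = (\<Sum>P\<in>NC m. \<Sum>B\<in>insert {} (outer P). f (card (outer (ins (Suc m) B P))))"
    by (rule sum.Sigma[symmetric])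
       (auto simp: finite_NC outer_def dest: finite_NC_member)
  also have "\<dots> = (\<Sum>P\<in>NC m. \<Sum>j\<le>card (outer P). f (Suc j))"
  proof (rule sum.cong[OF refl])
    fix P assume P: "P \<in> NC m"
    then have part: "partition_on {1..m} P" by (simp add: NC_def)
    have fo: "finite (outer P)" using finite_NC_member[OF P] by (simp add: outer_def)
    have oP: "outer P \<subseteq> P" by (auto simp: outer_def)
    have ne: "{} \<notin> outer P" using NC_block[OF P] oP by auto
    have out: "outer (ins (Suc m) B P) =
        insert (insert (Suc m) B) {A \<in> outer P. B = {} \<or> Max A < Max B}"
      if "B \<in> insert {} (outer P)" for B
      by (rule outer_ins[OF part]) (use that in auto)
    have new: "insert (Suc m) B \<notin> outer P" for B
      using NC_block[OF P] oP by force
    have card: "card (outer (ins (Suc m) B P)) = Suc (card {A \<in> outer P. B = {} \<or> Max A < Max B})"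
      if "B \<in> insert {} (outer P)" for B
      unfolding out[OF that] using fo new by (subst card_insert_disjoint) auto
    have inj: "inj_on Max (outer P)"
    proof (rule inj_onI)
      fix A B assume h: "A \<in> outer P" "B \<in> outer P" "Max A = Max B"
      then have "Max A \<in> A" "Max B \<in> B" using NC_block[OF P] oP by (meson Max_in subsetD)+
      then show "A = B" using partition_on_blocks_eq[OF part, of A B "Max A"] h oP by auto
    qed
    have "(\<Sum>B\<in>insert {} (outer P). f (card (outer (ins (Suc m) B P))))
        = f (Suc (card (outer P))) + (\<Sum>B\<in>outer P. f (card (outer (ins (Suc m) B P))))"
      using fo ne card[of "{}"] by (subst sum.insert) auto
    also have "(\<Sum>B\<in>outer P. f (card (outer (ins (Suc m) B P))))
        = (\<Sum>B\<in>outer P. f (Suc (card {A \<in> outer P. Max A < Max B})))"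
      by (rule sum.cong[OF refl]) (use card ne in \<open>auto intro!: arg_cong[of _ _ f] arg_cong[of _ _ card]\<close>)
    also have "\<dots> = (\<Sum>j<card (outer P). f (Suc j))"
      by (rule sum_rank[OF fo inj, where f = "\<lambda>j. f (Suc j)"])
    also have "f (Suc (card (outer P))) + \<dots> = (\<Sum>j\<le>card (outer P). f (Suc j))"
      by (simp add: lessThan_Suc_atMost[symmetric])
    finally show "(\<Sum>B\<in>insert {} (outer P). f (card (outer (ins (Suc m) B P))))
        = (\<Sum>j\<le>card (outer P). f (Suc j))" .
  qed
  finally show ?thesis .
qed

text \<open>Iterating \<open>sum_NC_Suc\<close> from \<open>f i = 2 ^ i\<close> turns \<open>f\<close>, after \<open>m\<close> steps, into the function
  \<open>i \<mapsto> (\<Sum>t=m..m + i. (2 * m + i) choose t)\<close>; at \<open>i = 0\<close> only the central binomial coefficient is left.\<close>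

lemma sum_central_binomials_Suc:
  "(\<Sum>t=Suc m..Suc m + i. (2 * Suc m + i) choose t)
     = (\<Sum>j\<le>i. \<Sum>t=m..m + Suc j. (2 * m + Suc j) choose t)"
proof (induction i)
  case 0
  show ?case by simp
next
  case (Suc i)
  define N where "N = 2 * m + 2 + i"
  have "(\<Sum>t=Suc m..Suc m + Suc i. (2 * Suc m + Suc i) choose t)
      = (\<Sum>t=m..m + Suc i. (Suc N) choose Suc t)"
    by (subst sum.shift_bounds_cl_Suc_ivl[symmetric]) (simp add: N_def)
  also have "\<dots> = (\<Sum>t=m..m + Suc i. N choose t) + (\<Sum>t=m..m + Suc i. N choose Suc t)"
    by (simp add: sum.distrib)
  \<comment> \<open>The last term split off here completes the first sum to the summand
    \<open>j = Suc i\<close> of the goal; what remains is the induction hypothesis.\<close>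
  also have "(\<Sum>t=m..m + Suc i. N choose Suc t) = (\<Sum>t=Suc m..Suc m + i. N choose t) + (N choose (m + Suc (Suc i)))"
    by (simp add: sum.shift_bounds_cl_Suc_ivl[symmetric] del: binomial_Suc_Suc)
  also have "(\<Sum>t=Suc m..Suc m + i. N choose t) = (\<Sum>j\<le>i. \<Sum>t=m..m + Suc j. (2 * m + Suc j) choose t)"
    using Suc by (simp add: N_def)
  finally show ?case by (simp add: N_def add_ac)
qed

lemma NC_0: "NC 0 = {{}}"
  by (auto simp: NC_def partition_on_def crossing_def)

text \<open>The parameter \<open>m\<close> makes the induction work: each step lowers
  \<open>k\<close> and raises \<open>m\<close> by one, so \<open>m + k\<close> is constant, until
  only the empty partition is left.\<close>

lemma sum_NC_binomial:
  "(\<Sum>P\<in>NC k. \<Sum>t=m..m + card (outer P). (2 * m + card (outer P)) choose t) = (2 * (m + k)) choose (m + k)"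
proof (induction k arbitrary: m)
  case 0
  show ?case by (simp add: NC_0 outer_def)
next
  case (Suc k)
  show ?case
    using sum_NC_Suc[of "\<lambda>i. \<Sum>t=m..m + i. (2 * m + i) choose t" k] Suc[of "Suc m"]
    unfolding sum_central_binomials_Suc by simp
qed

text \<open>At \<open>m = 0\<close> the inner sum is a full row of Pascal's triangle.\<close>

lemma sum_NC_outer: "(\<Sum>P\<in>NC k. 2 ^ card (outer P)) = (2 * k) choose k"
  using sum_NC_binomial[where m = 0, of k] by (simp add: atMost_atLeast0[symmetric] choose_row_sum)

section \<open>Self-complementary partitions and marked halves\<close>

definition mirror :: "nat \<Rightarrow> nat set \<Rightarrow> nat set" where
  "mirror n B = (\<lambda>i. n + 1 - i) ` B"

text \<open>For odd \<open>n\<close> the middle point belongs to the half and is the only point of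
  it whose mirror image lies there too.\<close>

definition half :: "nat \<Rightarrow> nat set" where
  "half n = {1..(n + 1) div 2}"

text \<open>The second component is the set of blocks that continue into the other half; a block containing
  the middle point (which exists for odd \<open>n\<close> only) always counts as continuing.\<close>

definition marked_halves :: "nat \<Rightarrow> (nat set set \<times> nat set set) set" where
  "marked_halves n = (SIGMA P:NC ((n + 1) div 2).
     {Q. Q \<subseteq> outer P \<and> (\<forall>B\<in>P. \<forall>x\<in>B. n + 1 - x = x \<longrightarrow> B \<in> Q)})"

definition mirror_ext :: "nat \<Rightarrow> nat set set \<Rightarrow> nat set \<Rightarrow> nat set" where
  "mirror_ext n Q B = (if B \<in> Q then B \<union> mirror n B else B)"

definition unfold_half :: "nat \<Rightarrow> nat set set \<times> nat set set \<Rightarrow> nat set set" where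
  "unfold_half n = (\<lambda>(P, Q). mirror_ext n Q ` P \<union> mirror n ` mirror_ext n Q ` P)"

text \<open>The marked traces come from the blocks equal to their mirror image; by
  \<open>self_complementary_block\<close>, no other block of a self-complementary noncrossing
  partition has points on both sides of the centre.\<close>

definition fold_half :: "nat \<Rightarrow> nat set set \<Rightarrow> nat set set \<times> nat set set" where
  "fold_half n R = ((\<lambda>B. B \<inter> half n) ` R - {{}}, (\<lambda>B. B \<inter> half n) ` {B \<in> R. mirror n B = B})"

section \<open>Reflection of blocks and the left half\<close>

lemma complement_eq_mirror: "complement n P = mirror n ` P"
  by (auto simp: complement_def mirror_def)

text \<open>Subtraction on naturals truncates at 0, which is why range conditions accompany this
  fact and the next ones.\<close>

lemma mirror_mirror: "B \<subseteq> {1..n} \<Longrightarrow> mirror n (mirror n B) = B"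
  by (force simp: mirror_def image_image intro: image_cong[where g = id, simplified])

lemma mem_mirror: "B \<subseteq> {1..n} \<Longrightarrow> x \<in> {1..n} \<Longrightarrow> n + 1 - x \<in> mirror n B \<longleftrightarrow> x \<in> B"
proof
  assume "B \<subseteq> {1..n}" "x \<in> {1..n}" "n + 1 - x \<in> mirror n B"
  then obtain i where "i \<in> B" "n + 1 - x = n + 1 - i" "i \<in> {1..n}" unfolding mirror_def by blast
  moreover from this have "i = x" using \<open>x \<in> {1..n}\<close> by (simp, linarith)
  ultimately show "x \<in> B" by simp
qed (simp add: mirror_def)

lemma mem_mirror_iff: "B \<subseteq> {1..n} \<Longrightarrow> x \<in> {1..n} \<Longrightarrow> x \<in> mirror n B \<longleftrightarrow> n + 1 - x \<in> B"
proof -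
  assume "B \<subseteq> {1..n}" and x: "x \<in> {1..n}"
  moreover have "n + 1 - x \<in> {1..n}" using x by auto
  moreover have "n + 1 - (n + 1 - x) = x" using x by auto
  ultimately show ?thesis using mem_mirror[of B n "n + 1 - x"] by (simp only:)
qed

lemma mirror_subset: "B \<subseteq> {1..n} \<Longrightarrow> mirror n B \<subseteq> {1..n}"
  by (force simp: mirror_def)

lemma mirror_eq_iff: "A \<subseteq> {1..n} \<Longrightarrow> B \<subseteq> {1..n} \<Longrightarrow> mirror n A = mirror n B \<longleftrightarrow> A = B"
  by (metis mirror_mirror)

lemma mirror_Un: "mirror n (A \<union> B) = mirror n A \<union> mirror n B"
  by (auto simp: mirror_def)

lemma half_subset: "half n \<subseteq> {1..n}"
  by (auto simp: half_def)

lemma mem_half_iff: "x \<in> {1..n} \<Longrightarrow> x \<in> half n \<longleftrightarrow> 2 * x \<le> n + 1"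
  by (auto simp: half_def)

lemma not_half: "x \<in> {1..n} \<Longrightarrow> x \<notin> half n \<Longrightarrow> n + 1 - x \<in> half n"
  by (auto simp: half_def)

lemma half_half: "x \<in> half n \<Longrightarrow> n + 1 - x \<in> half n \<Longrightarrow> n + 1 - x = x"
  by (auto simp: half_def)

text \<open>If \<open>B\<close> and its mirror image were distinct, they would be disjoint, which
  excludes the middle point; and the arcs from \<open>x\<close> to \<open>y\<close> and from
  \<open>n + 1 - y\<close> to \<open>n + 1 - x\<close>, symmetric to each other and both passing
  over the centre, would cross.\<close>

lemma self_complementary_block:
  assumes R: "R \<in> self_complementary_NC n" and B: "B \<in> R" and x: "x \<in> B" "x \<in> half n"
    and y: "n + 1 - x = x \<or> (y \<in> B \<and> y \<notin> half n)"
  shows "mirror n B = B"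
proof (rule ccontr)
  assume ne: "mirror n B \<noteq> B"
  have part: "partition_on {1..n} R" and nc: "\<not> crossing R" and cR: "mirror n ` R = R"
    using R by (auto simp: self_complementary_NC_def NC_def complement_eq_mirror)
  have Bn: "B \<subseteq> {1..n}" using part B by (auto simp: partition_on_def)
  have mB: "mirror n B \<in> R" using B cR by blast
  have disj: "z \<notin> mirror n B" if "z \<in> B" for z
    using partition_on_blocks_eq[OF part mB B] ne that by blast
  have xx: "n + 1 - x \<noteq> x"
    using disj[OF x(1)] mem_mirror[OF Bn, of x] x Bn by auto
  then have yB: "y \<in> B" "y \<notin> half n" using y by auto
  have m: "n + 1 - x \<in> mirror n B" "n + 1 - y \<in> mirror n B" using x yB Bn by (auto simp: mirror_def)
  have ne2: "x \<noteq> n + 1 - y" "y \<noteq> n + 1 - x" using disj x yB m by metis+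
  have rng: "x \<le> n" "1 \<le> x" "y \<le> n" "1 \<le> y" using x yB Bn by auto
  have h: "2 * x \<le> n + 1" "2 * y > n + 1" using x yB Bn mem_half_iff[of x n] mem_half_iff[of y n] by auto
  show False
  proof (cases "x < n + 1 - y")
    case True
    moreover from this have "n + 1 - y < y" "y < n + 1 - x" using h rng by linarith+
    ultimately show False
      using crossingI[OF B mB ne[symmetric] _ _ _ x(1) yB(1) m(2) m(1)] nc by blast
  next
    case False
    then have "n + 1 - y < x" using ne2 by linarith
    moreover from this have "x < n + 1 - x" "n + 1 - x < y" using h xx rng by linarith+
    ultimately show False
      using crossingI[OF mB B ne _ _ _ m(2) m(1) x(1) yB(1)] nc by blast
  qed
qed

section \<open>Unfolding marked halves and folding back\<close>

lemma unfold_half_mirror: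
  assumes "(P, Q) \<in> marked_halves n" "X \<in> unfold_half n (P, Q)"
  shows "mirror n X \<in> unfold_half n (P, Q)" "X \<subseteq> {1..n}" "X \<noteq> {}"
proof -
  have P: "P \<in> NC ((n + 1) div 2)" using assms by (auto simp: marked_halves_def)
  have "B \<subseteq> {1..n} \<and> B \<noteq> {}" if "B \<in> P" for B
    using NC_block[OF P that] half_subset[of n] unfolding half_def by blast
  then have e: "mirror_ext n Q B \<subseteq> {1..n} \<and> mirror_ext n Q B \<noteq> {} \<and> mirror n (mirror_ext n Q B) \<noteq> {}" if "B \<in> P" for B
    using that mirror_subset by (simp add: mirror_ext_def mirror_def)
  obtain B where B: "B \<in> P" "X = mirror_ext n Q B \<or> X = mirror n (mirror_ext n Q B)"
    using assms(2) unfolding unfold_half_def by auto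
  show "X \<subseteq> {1..n}" "X \<noteq> {}" using B e[OF B(1)] mirror_subset by auto
  have "mirror n X = mirror_ext n Q B \<or> mirror n X = mirror n (mirror_ext n Q B)"
    using B(2) e[OF B(1)] mirror_mirror by metis
  then show "mirror n X \<in> unfold_half n (P, Q)" using B(1) unfolding unfold_half_def by auto
qed

text \<open>The mirror image of an unmarked block misses the half, because the block of the middle
  point is always marked, and the extension of a marked block is its own mirror image. So a block
  meeting the half is the extension of its trace.\<close>

lemma unfold_half_block:
  assumes S: "(P, Q) \<in> marked_halves n"
  shows "B \<in> P \<Longrightarrow> mirror_ext n Q B \<inter> half n = B"
    and "X \<in> unfold_half n (P, Q) \<Longrightarrow> X \<inter> half n \<noteq> {} \<Longrightarrow> X \<inter> half n \<in> P \<and> X = mirror_ext n Q (X \<inter> half n)"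
proof -
  have P: "P \<in> NC ((n + 1) div 2)" and mid: "\<And>B x. B \<in> P \<Longrightarrow> x \<in> B \<Longrightarrow> n + 1 - x = x \<Longrightarrow> B \<in> Q"
    using S by (auto simp: marked_halves_def)
  have BH: "B \<subseteq> half n" if "B \<in> P" for B using NC_block[OF P that] by (auto simp: half_def)
  have mH: "mirror n B \<inter> half n \<subseteq> B" if "B \<in> P" for B
    using BH[OF that] half_half unfolding mirror_def by fastforce
  show *: "mirror_ext n Q B \<inter> half n = B" if "B \<in> P" for B
    using BH[OF that] mH[OF that] by (auto simp: mirror_ext_def)
  show "X \<inter> half n \<in> P \<and> X = mirror_ext n Q (X \<inter> half n)"
    if X: "X \<in> unfold_half n (P, Q)" "X \<inter> half n \<noteq> {}"
  proof -
    obtain B where B: "B \<in> P" "X = mirror_ext n Q B \<or> X = mirror n (mirror_ext n Q B)"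
      using X by (auto simp: unfold_half_def)
    have Bn: "B \<subseteq> {1..n}" using BH[OF B(1)] half_subset by blast
    have "X = mirror_ext n Q B"
    proof (cases "B \<in> Q")
      case True
      then have "mirror n (mirror_ext n Q B) = mirror_ext n Q B" using mirror_mirror[OF Bn] by (auto simp: mirror_ext_def mirror_Un)
      then show ?thesis using B by auto
    next
      case False
      have "mirror n B \<inter> half n = {}"
        using BH[OF B(1)] half_half mid[OF B(1)] False unfolding mirror_def by fastforce
      then show ?thesis using B X False by (auto simp: mirror_ext_def)
    qed
    then show ?thesis using *[OF B(1)] B by simp
  qed
qed

lemma unfold_half_mem:
  assumes S: "(P, Q) \<in> marked_halves n"
  shows "unfold_half n (P, Q) \<in> self_complementary_NC n"
proof -
  let ?U = "unfold_half n (P, Q)"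
  have P: "P \<in> NC ((n + 1) div 2)" and QP: "Q \<subseteq> outer P"
    using S by (auto simp: marked_halves_def)
  have part: "partition_on (half n) P" and nc: "\<not> crossing P" using P by (auto simp: NC_def half_def)
  note m = unfold_half_mirror[OF S] and blk = unfold_half_block[OF S]
  have eqH: "X = Y" if "X \<in> ?U" "Y \<in> ?U" "z \<in> X" "z \<in> Y" "z \<in> half n" for X Y z
    using blk(2)[of X] blk(2)[of Y] partition_on_blocks_eq[OF part, of "X \<inter> half n" "Y \<inter> half n" z] that
    by (metis IntI empty_iff)
  have eqU: "X = Y" if h: "X \<in> ?U" "Y \<in> ?U" "z \<in> X" "z \<in> Y" for X Y z
  proof (cases "z \<in> half n")
    case False
    have "z \<in> {1..n}" using m h by blast
    then have "n + 1 - z \<in> half n" using False not_half by blast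
    moreover have "n + 1 - z \<in> mirror n X" "n + 1 - z \<in> mirror n Y" using h by (auto simp: mirror_def)
    ultimately have "mirror n X = mirror n Y" using eqH m(1) h by blast
    then show ?thesis using mirror_eq_iff m(2) h by blast
  qed (use eqH h in blast)
  have cov: "z \<in> \<Union>?U" if "z \<in> half n" for z
  proof -
    obtain B where "B \<in> P" "z \<in> B" using part \<open>z \<in> half n\<close> by (auto simp: partition_on_def)
    then have "z \<in> mirror_ext n Q B" "mirror_ext n Q B \<in> ?U" by (auto simp: mirror_ext_def unfold_half_def)
    then show ?thesis by blast
  qed
  have pU: "partition_on {1..n} ?U"
  proof (rule partition_onI)
    show "\<Union>?U = {1..n}"
    proof (intro equalityI subsetI)
      fix z assume z: "z \<in> {1..n}"
      show "z \<in> \<Union>?U"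
      proof (cases "z \<in> half n")
        case False
        then obtain X where X: "X \<in> ?U" "n + 1 - z \<in> X" using cov not_half z by blast
        then have "z \<in> mirror n X" using z mem_mirror_iff m(2) by blast
        then show ?thesis using m(1) X by blast
      qed (use cov in blast)
    qed (use m(2) in blast)
    show "disjnt p q" if "p \<in> ?U" "q \<in> ?U" "p \<noteq> q" for p q
      using that eqU unfolding disjnt_iff by blast
    show "{} \<notin> ?U" using m(3) by blast
  qed
  have cU: "mirror n ` ?U = ?U"
  proof
    show "mirror n ` ?U \<subseteq> ?U" using m(1) by blast
    show "?U \<subseteq> mirror n ` ?U" using m(1,2) mirror_mirror by (metis imageI subsetI)
  qed
  \<comment> \<open>Both blocks have traces in \<open>P\<close>, since \<open>a < b\<close> puts
    \<open>a\<close> in the left half too. If only \<open>d\<close> is on the right, then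
    \<open>B\<close> is marked, hence outer, but has a point under the arc of \<open>A\<close> from
    \<open>a\<close> to \<open>c\<close>. If \<open>c\<close> and \<open>d\<close> are on the right,
    both blocks are marked, and the reflections of \<open>c\<close> and \<open>d\<close> nest one of
    them under the other.\<close>
  have key: False if h: "X \<in> ?U" "Y \<in> ?U" "X \<noteq> Y" "a < b" "b < c" "c < d" "a \<in> X" "c \<in> X" "b \<in> Y" "d \<in> Y"
    and bH: "b \<in> half n" for X Y a b c d
  proof -
    have rng: "a \<in> {1..n}" "b \<in> {1..n}" "c \<in> {1..n}" "d \<in> {1..n}" using m(2) h by blast+
    have aH: "a \<in> half n" using bH rng h by (auto simp: half_def)
    have dc: "d \<in> half n \<Longrightarrow> c \<in> half n" using rng h by (auto simp: half_def)
    define A B where "A = X \<inter> half n" and "B = Y \<inter> half n"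
    have A: "A \<in> P" "X = mirror_ext n Q A" using blk(2)[OF h(1)] aH h by (auto simp: A_def)
    have B: "B \<in> P" "Y = mirror_ext n Q B" using blk(2)[OF h(2)] bH h by (auto simp: B_def)
    have AB: "A \<noteq> B" using A B h by auto
    have ab: "a \<in> A" "b \<in> B" using aH bH h by (auto simp: A_def B_def)
    have An: "A \<subseteq> {1..n}" "B \<subseteq> {1..n}" using half_subset by (auto simp: A_def B_def)
    have mA: "A \<in> Q \<and> n + 1 - z \<in> A" if "z \<in> X" "z \<notin> half n" for z
    proof -
      have "z \<in> {1..n}" using m(2) h that by blast
      moreover have "z \<notin> A" using that by (simp add: A_def)
      moreover have "z \<in> mirror_ext n Q A" using that A(2) by simp
      ultimately show ?thesis using An mem_mirror_iff[of A n z] by (simp add: mirror_ext_def split: if_splits)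
    qed
    have mB: "B \<in> Q \<and> n + 1 - z \<in> B" if "z \<in> Y" "z \<notin> half n" for z
    proof -
      have "z \<in> {1..n}" using m(2) h that by blast
      moreover have "z \<notin> B" using that by (simp add: B_def)
      moreover have "z \<in> mirror_ext n Q B" using that B(2) by simp
      ultimately show ?thesis using An mem_mirror_iff[of B n z] by (simp add: mirror_ext_def split: if_splits)
    qed
    show False
    proof (cases "d \<in> half n")
      case True
      then have "c \<in> A" "d \<in> B" using dc h by (auto simp: A_def B_def)
      then show False using crossingI[of A P B a b c d] nc A B AB ab h by blast
    next
      case dH: False
      then have dB: "B \<in> Q" "n + 1 - d \<in> B" using mB h by auto
      then have Bo: "B \<in> outer P" using QP by auto
      show False
      proof (cases "c \<in> half n")
        case True
        then have "c \<in> A" using h by (auto simp: A_def)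
        then show False using outerD[OF Bo A(1)] ab h AB by blast
      next
        case False
        then have cA: "A \<in> Q" "n + 1 - c \<in> A" using mA h by auto
        then have Ao: "A \<in> outer P" using QP by auto
        have "n + 1 - d < n + 1 - c" using h rng by auto
        moreover have "b \<noteq> n + 1 - c"
          using partition_on_blocks_eq[OF part A(1) B(1)] AB cA ab by blast
        ultimately show False
          using outerD[OF Bo A(1) ab(1) cA(2) ab(2)] outerD[OF Ao B(1) dB(2) ab(2) cA(2)] h AB
          by (metis linorder_neqE_nat)
      qed
    qed
  qed
  have "\<not> crossing ?U"
  proof
    assume "crossing ?U"
    then obtain X Y a b c d where h: "X \<in> ?U" "Y \<in> ?U" "X \<noteq> Y" "a < b" "b < c" "c < d" 
      "a \<in> X" "c \<in> X" "b \<in> Y" "d \<in> Y" by (rule crossingE)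
    have rng: "a \<in> {1..n}" "b \<in> {1..n}" "c \<in> {1..n}" "d \<in> {1..n}" using m(2) h by blast+
    show False
    proof (cases "b \<in> half n")
      \<comment> \<open>Then \<open>c\<close> lies on the right as well. The reflection reverses the
        four points and exchanges the blocks, so the image of \<open>c\<close> becomes the second
        point and lies in the left half.\<close>
      case False
      then have "c \<notin> half n" using rng h by (auto simp: half_def)
      then have "n + 1 - c \<in> half n" using rng not_half by blast
      moreover have "mirror n Y \<noteq> mirror n X" using mirror_eq_iff m(2) h by blast
      moreover have "n + 1 - d < n + 1 - c" "n + 1 - c < n + 1 - b" "n + 1 - b < n + 1 - a"
        using h rng by auto
      ultimately show False
        using key[OF m(1)[OF h(2)] m(1)[OF h(1)]] h by (metis imageI mirror_def)
    qed (use key h in blast)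
  qed
  then show ?thesis using pU cU by (simp add: self_complementary_NC_def NC_def complement_eq_mirror)
qed

text \<open>Restriction creates no crossing. The trace of a self-mirrored block is outer, since an
  arc of another block over its point \<open>b\<close> within the left half would cross the arc from
  \<open>b\<close> to \<open>n + 1 - b\<close>.\<close>

lemma fold_half_mem:
  assumes R: "R \<in> self_complementary_NC n"
  shows "fold_half n R \<in> marked_halves n"
proof -
  define P where "P = (\<lambda>B. B \<inter> half n) ` R - {{}}"
  define Q where "Q = (\<lambda>B. B \<inter> half n) ` {B \<in> R. mirror n B = B}"
  have part: "partition_on {1..n} R" and nc: "\<not> crossing R" and cR: "mirror n ` R = R"
    using R by (auto simp: self_complementary_NC_def NC_def complement_eq_mirror)
  have pP: "partition_on (half n) P"
  proof (rule partition_onI)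
    show "\<Union>P = half n"
    proof -
      have "\<Union>P = \<Union>R \<inter> half n" by (auto simp: P_def)
      then show ?thesis using part half_subset by (auto simp: partition_on_def)
    qed
    show "disjnt p q" if "p \<in> P" "q \<in> P" "p \<noteq> q" for p q
      using that partition_on_blocks_eq[OF part] unfolding P_def disjnt_iff by blast
    show "{} \<notin> P" by (simp add: P_def)
  qed
  have "\<not> crossing P"
  proof
    assume "crossing P"
    then obtain X Y a b c d where h: "X \<in> P" "Y \<in> P" "X \<noteq> Y" "a < b" "b < c" "c < d" 
      "a \<in> X" "c \<in> X" "b \<in> Y" "d \<in> Y" by (rule crossingE)
    then obtain X' Y' where "X' \<in> R" "X = X' \<inter> half n" "Y' \<in> R" "Y = Y' \<inter> half n"
      by (auto simp: P_def)
    then show False using crossingI[of X' R Y' a b c d] nc h by blast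
  qed
  then have PN: "P \<in> NC ((n + 1) div 2)" using pP by (simp add: NC_def half_def)
  have "Q \<subseteq> outer P"
  proof
    fix Z assume "Z \<in> Q"
    then obtain B where B: "B \<in> R" "mirror n B = B" and Z: "Z = B \<inter> half n" by (auto simp: Q_def)
    have Bn: "B \<subseteq> {1..n}" "B \<noteq> {}" using B part by (auto simp: partition_on_def)
    have cB: "z \<in> B \<Longrightarrow> n + 1 - z \<in> B" for z using B by (metis imageI mirror_def)
    have "B \<inter> half n \<noteq> {}" using Bn cB not_half by (metis IntI all_not_in_conv subsetD)
    then have "Z \<in> P" using B Z by (auto simp: P_def)
    moreover have "A = Z" if h: "A \<in> P" "a \<in> A" "c \<in> A" "b \<in> Z" "a < b" "b < c" for A a b c
    proof (rule ccontr)
      assume "A \<noteq> Z"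
      obtain A' where A': "A' \<in> R" "A = A' \<inter> half n" using h by (auto simp: P_def)
      then have ne: "A' \<noteq> B" using \<open>A \<noteq> Z\<close> Z by auto
      have "c \<noteq> n + 1 - b"
        using partition_on_blocks_eq[OF part A'(1) B(1)] ne cB h Z A' by blast
      moreover have "2 * c \<le> n + 1" "2 * b \<le> n + 1" 
        using h A' Z by (auto simp: half_def)
      ultimately have "c < n + 1 - b" by linarith
      then show False
        using crossingI[of A' R B a b c "n + 1 - b"] nc A' B(1) ne h cB Z by blast
    qed
    ultimately show "Z \<in> outer P" unfolding outer_def by blast
  qed
  moreover have "Z \<in> Q" if h: "Z \<in> P" "x \<in> Z" "n + 1 - x = x" for Z x
  proof -
    obtain B where B: "B \<in> R" "Z = B \<inter> half n" using h by (auto simp: P_def)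
    then have "mirror n B = B" using self_complementary_block[OF R B(1), of x] h by auto
    then show ?thesis using B by (auto simp: Q_def)
  qed
  ultimately have "(P, Q) \<in> marked_halves n" using PN unfolding marked_halves_def by blast
  then show ?thesis by (simp add: fold_half_def P_def Q_def)
qed

lemma fold_unfold_half:
  assumes S: "(P, Q) \<in> marked_halves n"
  shows "fold_half n (unfold_half n (P, Q)) = (P, Q)"
proof -
  let ?U = "unfold_half n (P, Q)"
  have P: "P \<in> NC ((n + 1) div 2)" and QP: "Q \<subseteq> P"
    and mid: "\<And>B x. B \<in> P \<Longrightarrow> x \<in> B \<Longrightarrow> n + 1 - x = x \<Longrightarrow> B \<in> Q"
    using S by (auto simp: marked_halves_def outer_def)
  note m = unfold_half_mirror[OF S] and blk = unfold_half_block[OF S]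
  have BH: "B \<subseteq> half n" "B \<noteq> {}" "B \<subseteq> {1..n}" if "B \<in> P" for B 
    using NC_block[OF P that] half_subset[of n] by (auto simp: half_def)
  have eU: "mirror_ext n Q B \<in> ?U" if "B \<in> P" for B using that by (auto simp: unfold_half_def)
  have "(\<lambda>B. B \<inter> half n) ` ?U - {{}} = P"
  proof (intro equalityI subsetI)
    fix B assume "B \<in> P"
    then show "B \<in> (\<lambda>B. B \<inter> half n) ` ?U - {{}}" using blk(1) eU BH by (metis DiffI imageI singletonD)
  qed (use blk(2) in auto)
  moreover have "(\<lambda>B. B \<inter> half n) ` {B \<in> ?U. mirror n B = B} = Q"
  proof (intro equalityI subsetI)
    fix Z assume "Z \<in> (\<lambda>B. B \<inter> half n) ` {B \<in> ?U. mirror n B = B}"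
    then obtain X where X: "X \<in> ?U" "mirror n X = X" "Z = X \<inter> half n" by auto
    have cX: "z \<in> X \<Longrightarrow> n + 1 - z \<in> X" for z using X by (metis imageI mirror_def)
    have "Z \<noteq> {}" unfolding X(3) using m(2,3)[OF X(1)] cX not_half by (metis IntI all_not_in_conv subsetD)
    then have Z: "Z \<in> P" "X = mirror_ext n Q Z" using blk(2) X by auto
    show "Z \<in> Q"
    proof (rule ccontr)
      assume "Z \<notin> Q"
      \<comment> \<open>So \<open>X\<close> lies in the left half and is closed under reflection; it
        could only consist of the middle point, whose block is always marked.\<close>
      then have "X = Z" using Z by (simp add: mirror_ext_def)
      obtain z where "z \<in> Z" using \<open>Z \<noteq> {}\<close> by auto
      then have "n + 1 - z = z" using cX half_half BH(1)[OF Z(1)] \<open>X = Z\<close> by blast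
      then show False using mid Z \<open>z \<in> Z\<close> \<open>Z \<notin> Q\<close> by blast
    qed
  next
    fix B assume B: "B \<in> Q"
    then have "B \<in> P" using QP by auto
    then have "mirror_ext n Q B \<inter> half n = B" "mirror_ext n Q B \<in> ?U" using blk(1) eU by blast+
    moreover have "mirror n (mirror_ext n Q B) = mirror_ext n Q B"
      using B mirror_mirror[OF BH(3)[OF \<open>B \<in> P\<close>]] by (auto simp: mirror_ext_def mirror_Un)
    ultimately show "B \<in> (\<lambda>B. B \<inter> half n) ` {B \<in> ?U. mirror n B = B}"
      by blast
  qed
  ultimately show ?thesis by (simp add: fold_half_def)
qed

text \<open>A block meeting the left half either equals its mirror image, and is its trace together
  with the reflected trace, or lies within the half by \<open>self_complementary_block\<close>. The
  remaining blocks are mirror images of blocks of the second type.\<close>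

lemma unfold_fold_half:
  assumes R: "R \<in> self_complementary_NC n"
  shows "unfold_half n (fold_half n R) = R"
proof -
  define P where "P = (\<lambda>B. B \<inter> half n) ` R - {{}}"
  define Q where "Q = (\<lambda>B. B \<inter> half n) ` {B \<in> R. mirror n B = B}"
  have part: "partition_on {1..n} R" and cR: "mirror n ` R = R"
    using R by (auto simp: self_complementary_NC_def NC_def complement_eq_mirror)
  have Bn: "B \<subseteq> {1..n}" "B \<noteq> {}" if "B \<in> R" for B using that part by (auto simp: partition_on_def)
  have ext: "mirror_ext n Q (B \<inter> half n) = B" if B: "B \<in> R" "B \<inter> half n \<noteq> {}" for B
  proof (cases "mirror n B = B")
    case True
    then have "B \<inter> half n \<in> Q" using B by (auto simp: Q_def)
    moreover have "B \<inter> half n \<union> mirror n (B \<inter> half n) = B"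
    proof (intro equalityI subsetI)
      fix z assume z: "z \<in> B"
      then have zn: "z \<in> {1..n}" using Bn B by blast
      show "z \<in> B \<inter> half n \<union> mirror n (B \<inter> half n)"
      proof (cases "z \<in> half n")
        case False
        then have "n + 1 - z \<in> B \<inter> half n"
          using not_half[OF zn] z True by (metis IntI imageI mirror_def)
        then show ?thesis using mem_mirror_iff[of "B \<inter> half n" n z] zn half_subset by blast
      qed (use z in blast)
    qed (use True in \<open>auto simp: mirror_def\<close>)
    ultimately show ?thesis by (simp add: mirror_ext_def)
  next
    case False
    then have "B \<subseteq> half n" using self_complementary_block[OF R B(1)] B by blast
    moreover have "B \<inter> half n \<notin> Q"
    proof
      assume "B \<inter> half n \<in> Q"
      then obtain B' where B': "B' \<in> R" "mirror n B' = B'" "B \<inter> half n = B' \<inter> half n" by (auto simp: Q_def)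
      then have "B' = B" using partition_on_blocks_eq[OF part B'(1) B(1)] B by blast
      then show False using False B' by simp
    qed
    ultimately show ?thesis by (simp add: mirror_ext_def inf.absorb1)
  qed
  have "unfold_half n (P, Q) = R"
  proof (intro equalityI subsetI)
    fix X assume "X \<in> unfold_half n (P, Q)"
    then obtain B where B: "B \<in> R" "B \<inter> half n \<noteq> {}"
      "X = mirror_ext n Q (B \<inter> half n) \<or> X = mirror n (mirror_ext n Q (B \<inter> half n))"
      by (auto simp: unfold_half_def P_def)
    then show "X \<in> R" using ext cR by auto
  next
    fix X assume X: "X \<in> R"
    have *: "B \<in> mirror_ext n Q ` P" if "B \<in> R" "B \<inter> half n \<noteq> {}" for B
    proof -
      have "B \<inter> half n \<in> P" using that by (auto simp: P_def)
      then show ?thesis using ext[OF that] by (metis imageI)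
    qed
    show "X \<in> unfold_half n (P, Q)"
    proof (cases "X \<inter> half n = {}")
      case True
      obtain z where z: "z \<in> X" using Bn X by blast
      then have "n + 1 - z \<in> half n" using not_half True Bn[OF X] by blast
      moreover have "n + 1 - z \<in> mirror n X" using z by (auto simp: mirror_def)
      moreover have "mirror n X \<in> R" using X cR by blast
      ultimately have "mirror n X \<in> mirror_ext n Q ` P" using * by blast
      then have "mirror n (mirror n X) \<in> unfold_half n (P, Q)" by (auto simp: unfold_half_def)
      then show ?thesis using mirror_mirror Bn[OF X] by simp
    qed (use * X in \<open>auto simp: unfold_half_def\<close>)
  qed
  then show ?thesis by (simp add: fold_half_def P_def Q_def)
qed

section \<open>The number of self-complementary noncrossing partitions\<close>

lemma card_self_complementary_NC_marked_halves:
  "card (self_complementary_NC n) = card (marked_halves n)"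
proof -
  have "bij_betw (unfold_half n) (marked_halves n) (self_complementary_NC n)"
    by (rule bij_betw_byWitness[where f' = "fold_half n"])
       (auto simp: fold_unfold_half unfold_fold_half unfold_half_mem fold_half_mem)
  then show ?thesis by (simp add: bij_betw_same_card)
qed

text \<open>There is no middle point, so every set of outer blocks is an admissible marking.\<close>

lemma card_marked_halves_even: "card (marked_halves (2 * k)) = (2 * k) choose k"
proof -
  have "2 * k + 1 - x = x \<longleftrightarrow> False" for x by presburger
  then have "marked_halves (2 * k) = (SIGMA P:NC k. Pow (outer P))"
    by (auto simp: marked_halves_def)
  moreover have fin: "finite (outer P)" if "P \<in> NC k" for P
    using finite_NC_member[OF that] by (simp add: outer_def)
  ultimately show ?thesis
    using sum_NC_outer[of k] by (simp add: finite_NC card_Pow)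
qed

text \<open>The middle point is the largest point of the half, so its block \<open>D\<close> is
  outer; as \<open>D\<close> must be marked, exactly one half of all sets of outer blocks
  remain.\<close>

lemma card_marked_halves_odd: "card (marked_halves (2 * k + 1)) = (2 * k + 1) choose k"
proof -
  have mid: "2 * k + 1 + 1 - x = x \<longleftrightarrow> x = k + 1" for x by presburger
  define F where "F = (\<lambda>P. {Q. Q \<subseteq> outer P \<and> (\<forall>B\<in>P. \<forall>x\<in>B. x = k + 1 \<longrightarrow> B \<in> Q)})"
  have M: "marked_halves (2 * k + 1) = (SIGMA P:NC (k + 1). F P)"
    unfolding marked_halves_def mid F_def by simp
  have "finite (F P) \<and> 2 * card (F P) = 2 ^ card (outer P)" if P: "P \<in> NC (k + 1)" for P
  proof -
    have part: "partition_on {1..k + 1} P" using P by (simp add: NC_def)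
    have fin: "finite (outer P)" using finite_NC_member[OF P] by (simp add: outer_def)
    have "k + 1 \<in> \<Union>P" using part by (simp add: partition_on_def)
    then obtain D where D: "D \<in> P" "k + 1 \<in> D" by blast
    have le: "x \<le> k + 1" if "A \<in> P" "x \<in> A" for A x using NC_block[OF P] that by fastforce
    have blockD: "B \<in> P \<Longrightarrow> k + 1 \<in> B \<Longrightarrow> B = D" for B
      using partition_on_blocks_eq[OF part _ D(1) _ D(2)] by blast
    have Do: "D \<in> outer P"
    proof -
      have "A = D" if h: "A \<in> P" "a \<in> A" "c \<in> A" "b \<in> D" "a < b" "b < c" for A a b c
      proof (rule ccontr)
        assume ne: "A \<noteq> D"
        have "c \<noteq> k + 1" using blockD h ne by blast
        then have "c < k + 1" using le h by fastforce
        then have "crossing P" using crossingI[of A P D a b c "k + 1"] h D ne by blast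
        then show False using P by (simp add: NC_def)
      qed
      then show ?thesis using D unfolding outer_def by blast
    qed
    have "F P = insert D ` Pow (outer P - {D})"
    proof (intro equalityI subsetI)
      fix Q assume "Q \<in> F P"
      then have "Q \<subseteq> outer P" "D \<in> Q" using D by (auto simp: F_def)
      then have "Q = insert D (Q - {D})" "Q - {D} \<in> Pow (outer P - {D})" by auto
      then show "Q \<in> insert D ` Pow (outer P - {D})" by blast
    qed (use Do blockD in \<open>auto simp: F_def\<close>)
    moreover have "inj_on (insert D) (Pow (outer P - {D}))"
    proof (rule inj_onI)
      fix Q Q' assume h: "Q \<in> Pow (outer P - {D})" "Q' \<in> Pow (outer P - {D})" "insert D Q = insert D Q'"
      then have "D \<notin> Q" "D \<notin> Q'" by auto
      then show "Q = Q'" using h(3) by (simp add: insert_ident)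
    qed
    ultimately have "card (F P) = 2 ^ card (outer P - {D})"
      using fin by (simp add: card_image card_Pow)
    moreover have "card (outer P) = Suc (card (outer P - {D}))"
      by (rule card.remove[OF fin Do])
    moreover have "finite (F P)" unfolding F_def using fin by simp
    ultimately show ?thesis by simp
  qed
  then have "2 * card (marked_halves (2 * k + 1)) = (\<Sum>P\<in>NC (k + 1). 2 ^ card (outer P))"
    unfolding M by (simp add: finite_NC sum_distrib_left)
  also have "\<dots> = (2 * (k + 1)) choose (k + 1)" by (rule sum_NC_outer)
  also have "\<dots> = 2 * ((2 * k + 1) choose k)"
    using binomial_symmetric[of k "2 * k + 1"] by simp
  finally show ?thesis by simp
qed

lemma card_self_complementary_NC: "card (self_complementary_NC n) = n choose (n div 2)"
proof (cases "even n")
  case True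
  then obtain k where "n = 2 * k" by (elim evenE)
  then show ?thesis by (simp add: card_self_complementary_NC_marked_halves card_marked_halves_even)
next
  case False
  then obtain k where "n = 2 * k + 1" by (elim oddE)
  then show ?thesis
    using card_marked_halves_odd[of k] by (simp add: card_self_complementary_NC_marked_halves)
qed

section \<open>Counting achiral orbits\<close>

text \<open>The numbers \<open>2 * i\<close> and \<open>2 * i + 1\<close> with \<open>i < m\<close>
  run through all \<open>j < 2 * m\<close>, an interval that meets every residue class modulo
  \<open>m\<close> twice.\<close>

lemma card_residues:
  assumes "m \<ge> (1::nat)"
  shows "card {i. i < m \<and> k mod m = (2 * i) mod m} + card {i. i < m \<and> k mod m = (2 * i + 1) mod m} = 2"
    (is "card ?E + card ?O = 2")
proof -
  have "{j. j < 2 * m \<and> k mod m = j mod m} = (\<lambda>i. 2 * i) ` ?E \<union> (\<lambda>i. 2 * i + 1) ` ?O"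
  proof (intro equalityI subsetI)
    fix j assume j: "j \<in> {j. j < 2 * m \<and> k mod m = j mod m}"
    show "j \<in> (\<lambda>i. 2 * i) ` ?E \<union> (\<lambda>i. 2 * i + 1) ` ?O"
    proof (cases "even j")
      case True
      then obtain i where "j = 2 * i" by (elim evenE)
      then show ?thesis using j by auto
    next
      case False
      then obtain i where "j = 2 * i + 1" by (elim oddE)
      then show ?thesis using j by auto
    qed
  qed auto
  moreover have "(\<lambda>i. 2 * i) ` ?E \<inter> (\<lambda>i. 2 * i + 1) ` ?O = {}"
  proof -
    have "2 * i \<noteq> 2 * j + 1" for i j :: nat by presburger
    then show ?thesis by blast
  qed
  ultimately have "card {j. j < 2 * m \<and> k mod m = j mod m} = card ?E + card ?O"
    by (simp add: card_Un_disjoint card_image inj_on_def)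
  moreover have "{j. j < 2 * m \<and> k mod m = j mod m} = {k mod m, k mod m + m}"
  proof -
    have *: "j = k mod m \<or> j = k mod m + m" if "j < 2 * m" "k mod m = j mod m" for j
    proof (cases "j < m")
      case False
      then have "j mod m = j - m" using that by (simp add: le_mod_geq)
      then show ?thesis using that False by simp
    qed (use that in simp)
    show ?thesis
    proof (intro equalityI subsetI)
      fix j assume "j \<in> {k mod m, k mod m + m}"
      moreover have "k mod m < m" using assms by simp
      ultimately show "j \<in> {j. j < 2 * m \<and> k mod m = j mod m}" by auto
    qed (use * in blast)
  qed
  ultimately show ?thesis using assms by simp
qed

text \<open>Assumption \<open>crcr\<close> is the dihedral relation that conjugation by
  \<open>c\<close> inverts \<open>r\<close>, stated without an inverse of \<open>r\<close>.\<close>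

locale dihedral_action =
  fixes X :: "'a set" and r c :: "'a \<Rightarrow> 'a" and n :: nat
  assumes finite_X: "finite X" and n_pos: "n \<ge> 1"
    and r_closed: "x \<in> X \<Longrightarrow> r x \<in> X" and c_closed: "x \<in> X \<Longrightarrow> c x \<in> X"
    and r_cyclic: "x \<in> X \<Longrightarrow> (r ^^ n) x = x"
    and c_invol: "x \<in> X \<Longrightarrow> c (c x) = x"
    and crcr: "x \<in> X \<Longrightarrow> c (r (c (r x))) = x"
begin

text \<open>Exponents start at 1 as in \<open>rotation_class\<close>; since \<open>r ^^ n\<close> is
  the identity on \<open>X\<close>, this is the full orbit of a point of \<open>X\<close>.\<close>

definition orb :: "'a \<Rightarrow> 'a set" where
  "orb x = {(r ^^ i) x | i. i \<ge> 1}"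

definition period :: "'a \<Rightarrow> nat" where
  "period x = (LEAST i. i \<ge> 1 \<and> (r ^^ i) x = x)"

lemma rpow_closed: "x \<in> X \<Longrightarrow> (r ^^ i) x \<in> X"
  by (induction i) (auto simp: r_closed)

lemma rpow_mult: "x \<in> X \<Longrightarrow> (r ^^ (n * i)) x = x"
  by (induction i) (auto simp: funpow_add r_cyclic)

text \<open>Since \<open>n >= 1\<close>, the power \<open>r ^^ (n * i - i)\<close> undoes
  \<open>r ^^ i\<close>.\<close>

lemma rpow_inject:
  assumes "x \<in> X" "y \<in> X" "(r ^^ i) x = (r ^^ i) y"
  shows "x = y"
proof -
  have "(r ^^ (n * i - i)) ((r ^^ i) x) = (r ^^ (n * i - i)) ((r ^^ i) y)" using assms by simp
  moreover have "n * i - i + i = n * i" using n_pos by simp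
  ultimately show ?thesis using rpow_mult assms by (metis comp_apply funpow_add)
qed

lemma period: assumes "x \<in> X" shows "period x \<ge> 1" "(r ^^ period x) x = x"
proof -
  have "period x \<ge> 1 \<and> (r ^^ period x) x = x"
    unfolding period_def by (rule LeastI[of _ n]) (use n_pos r_cyclic assms in auto)
  then show "period x \<ge> 1" "(r ^^ period x) x = x" by auto
qed

text \<open>Exponents reduce modulo the period, and two equal powers below it would give a positive
  exponent smaller than the period that fixes \<open>x\<close>.\<close>

lemma rpow_eq_iff:
  assumes x: "x \<in> X"
  shows "(r ^^ i) x = (r ^^ j) x \<longleftrightarrow> i mod period x = j mod period x"
proof -
  let ?m = "period x"
  have m: "(r ^^ (i mod ?m)) x = (r ^^ i) x" for i
    using funpow_mod_eq[OF period(2)[OF x]] .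
  have dist: "(r ^^ i) x \<noteq> (r ^^ j) x" if "i < j" "j < ?m" for i j
  proof
    assume eq: "(r ^^ i) x = (r ^^ j) x"
    have "(r ^^ i) ((r ^^ (j - i)) x) = (r ^^ i) x"
      using eq that by (simp add: funpow_add[symmetric, THEN fun_cong, unfolded comp_def])
    then have "(r ^^ (j - i)) x = x" using rpow_inject rpow_closed x by blast
    then have "?m \<le> j - i" unfolding period_def using that by (intro Least_le) auto
    then show False using that by simp
  qed
  have "i mod ?m < ?m" "j mod ?m < ?m" using period(1)[OF x] by auto
  then show ?thesis using dist m by (metis linorder_neqE_nat)
qed

lemma orb_eq_image:
  assumes "x \<in> X" shows "orb x = (\<lambda>i. (r ^^ i) x) ` {..<period x}"
proof (intro equalityI subsetI)
  fix y assume "y \<in> orb x"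
  then obtain i where "y = (r ^^ i) x" by (auto simp: orb_def)
  then have "y = (r ^^ (i mod period x)) x" using rpow_eq_iff[OF assms, of i "i mod period x"] by simp
  moreover have "i mod period x < period x" using period(1)[OF assms] by simp
  ultimately show "y \<in> (\<lambda>i. (r ^^ i) x) ` {..<period x}" by blast
next
  fix y assume "y \<in> (\<lambda>i. (r ^^ i) x) ` {..<period x}"
  then obtain i where "y = (r ^^ i) x" by blast
  then have "y = (r ^^ (i + period x)) x" using rpow_eq_iff[OF assms, of i "i + period x"] by simp
  then show "y \<in> orb x" using period(1)[OF assms] unfolding orb_def by fastforce
qed

lemma self_in_orb: "x \<in> X \<Longrightarrow> x \<in> orb x"
  using period(1)[of x] by (auto simp: orb_eq_image image_iff intro!: bexI[of _ 0])

lemma orb_subset: "x \<in> X \<Longrightarrow> orb x \<subseteq> X"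
  by (auto simp: orb_def rpow_closed)

lemma orb_eq:
  assumes x: "x \<in> X" and y: "y \<in> orb x" shows "orb y = orb x"
proof -
  have sub: "orb b \<subseteq> orb a" if "b \<in> orb a" for a b
    using that by (auto simp: orb_def funpow_add[symmetric, THEN fun_cong, unfolded comp_def])
  obtain i where i: "y = (r ^^ i) x" "i < period x" using y x by (auto simp: orb_eq_image)
  have "(r ^^ (period x - i)) y = x"
    using i period(2)[OF x] by (simp add: funpow_add[symmetric, THEN fun_cong, unfolded comp_def])
  then have "x \<in> orb y" unfolding orb_def
    by (intro CollectI exI[of _ "period x - i"]) (use i in auto)
  then show ?thesis using sub y by blast
qed

text \<open>Iterates \<open>r (c (r x)) = c x\<close>, which is \<open>crcr\<close> with the outer
  \<open>c\<close> cancelled; it lets powers of \<open>r\<close> pass \<open>c\<close> without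
  inverses.\<close>

lemma rpow_c_rpow: "x \<in> X \<Longrightarrow> (r ^^ i) (c ((r ^^ i) x)) = c x"
proof (induction i)
  case (Suc i)
  have y: "(r ^^ i) x \<in> X" using rpow_closed Suc by blast
  have "r (c (r ((r ^^ i) x))) = c ((r ^^ i) x)"
    using crcr[OF y] c_invol by (metis c_closed r_closed y)
  then have "(r ^^ Suc i) (c ((r ^^ Suc i) x)) = (r ^^ i) (c ((r ^^ i) x))"
    by (simp add: funpow_swap1)
  then show ?case using Suc by simp
qed simp

lemma c_image_orb:
  assumes x: "x \<in> X" shows "c ` orb x = orb (c x)"
proof -
  have *: "c ` orb y \<subseteq> orb (c y)" if y: "y \<in> X" for y
  proof
    fix z assume "z \<in> c ` orb y"
    then obtain i where i: "z = c ((r ^^ i) y)" by (auto simp: orb_def)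
    have zX: "z \<in> X" using i rpow_closed c_closed y by blast
    have "(r ^^ i) z = c y" using rpow_c_rpow[OF y, of i] i by simp
    \<comment> \<open>One more rotation makes the exponent positive on both sides, as
      \<open>orb\<close> requires.\<close>
    have "(r ^^ Suc i) z = r (c y)" using \<open>(r ^^ i) z = c y\<close> by simp
    then have "r (c y) \<in> orb z" unfolding orb_def by (metis (mono_tags, lifting) le_add1 mem_Collect_eq plus_1_eq_Suc)
    moreover have "r (c y) \<in> orb (c y)" unfolding orb_def by (force intro!: exI[of _ 1])
    ultimately have "orb z = orb (c y)" using orb_eq zX c_closed y by metis
    then show "z \<in> orb (c y)" using self_in_orb zX by blast
  qed
  have "orb (c x) \<subseteq> c ` orb x"
  proof
    fix z assume z: "z \<in> orb (c x)"
    then have "z \<in> X" using orb_subset c_closed x by blast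
    moreover have "c z \<in> orb x" using *[OF c_closed[OF x]] z c_invol[OF x] by auto
    ultimately show "z \<in> c ` orb x" using c_invol by (metis imageI)
  qed
  then show ?thesis using * x by blast
qed

text \<open>Write \<open>c x\<close> as \<open>(r ^^ k) x\<close>. By \<open>rpow_c_rpow\<close>,
  the point \<open>(r ^^ i) x\<close> is fixed by \<open>c\<close> iff \<open>k\<close> is congruent
  to \<open>2 * i\<close> modulo the period, and by \<open>c\<close> after \<open>r\<close> iff
  \<open>k\<close> is congruent to \<open>2 * i + 1\<close>; \<open>card_residues\<close> counts
  both together.\<close>

lemma card_fixed_orb:
  assumes x: "x \<in> X" and ach: "c ` orb x = orb x"
  shows "card {y \<in> orb x. c y = y} + card {y \<in> orb x. c (r y) = y} = 2"
proof -
  have "c x \<in> orb x" using ach self_in_orb[OF x] by blast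
  then obtain k where k: "c x = (r ^^ k) x" by (auto simp: orb_def)
  let ?m = "period x"
  have fix1: "c ((r ^^ i) x) = (r ^^ i) x \<longleftrightarrow> k mod ?m = (2 * i) mod ?m" for i
  proof -
    have "c ((r ^^ i) x) = (r ^^ i) x \<longleftrightarrow> (r ^^ i) (c ((r ^^ i) x)) = (r ^^ i) ((r ^^ i) x)"
      using rpow_inject rpow_closed c_closed x by metis
    also have "\<dots> \<longleftrightarrow> (r ^^ k) x = (r ^^ (2 * i)) x"
      unfolding rpow_c_rpow[OF x] k by (simp add: mult_2 funpow_add)
    finally show ?thesis using rpow_eq_iff[OF x] by simp
  qed
  have fix2: "c (r ((r ^^ i) x)) = (r ^^ i) x \<longleftrightarrow> k mod ?m = (2 * i + 1) mod ?m" for i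
  proof -
    have "c ((r ^^ Suc i) x) = (r ^^ i) x \<longleftrightarrow> (r ^^ Suc i) (c ((r ^^ Suc i) x)) = (r ^^ Suc i) ((r ^^ i) x)"
      using rpow_inject rpow_closed c_closed x by metis
    also have "\<dots> \<longleftrightarrow> (r ^^ k) x = (r ^^ (Suc i + i)) x"
      unfolding rpow_c_rpow[OF x] k by (simp only: funpow_add comp_apply)
    finally show ?thesis unfolding rpow_eq_iff[OF x] by (simp add: mult_2)
  qed
  have inj: "inj_on (\<lambda>i. (r ^^ i) x) {..<?m}"
    by (rule inj_onI) (simp add: rpow_eq_iff[OF x])
  have "{y \<in> orb x. c y = y} = (\<lambda>i. (r ^^ i) x) ` {i. i < ?m \<and> k mod ?m = (2 * i) mod ?m}"
    unfolding orb_eq_image[OF x] using fix1 by auto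
  moreover have "{y \<in> orb x. c (r y) = y} = (\<lambda>i. (r ^^ i) x) ` {i. i < ?m \<and> k mod ?m = (2 * i + 1) mod ?m}"
    unfolding orb_eq_image[OF x] using fix2 by auto
  moreover have sub1: "{i. i < ?m \<and> k mod ?m = (2 * i) mod ?m} \<subseteq> {..<?m}"
    and sub2: "{i. i < ?m \<and> k mod ?m = (2 * i + 1) mod ?m} \<subseteq> {..<?m}" by auto
  ultimately show ?thesis
    using card_residues[OF period(1)[OF x], of k] card_image[OF inj_on_subset[OF inj]] sub1 sub2
    by simp
qed

text \<open>A point fixed by \<open>c\<close> or by \<open>c\<close> after \<open>r\<close> lies in
  an achiral orbit, so the fixed points can be counted orbit by orbit, two for each achiral
  orbit.\<close>

lemma card_achiral_orbits:
  "2 * card {A \<in> orb ` X. c ` A = A} = card {x \<in> X. c x = x} + card {x \<in> X. c (r x) = x}"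
proof -
  let ?Ac = "{A \<in> orb ` X. c ` A = A}"
  have fin: "finite ?Ac" using finite_X by simp
  have disj: "A \<inter> B = {}" if "A \<in> ?Ac" "B \<in> ?Ac" "A \<noteq> B" for A B
  proof (rule ccontr)
    assume "A \<inter> B \<noteq> {}"
    then obtain z where "z \<in> A" "z \<in> B" by blast
    then have "A = orb z" "B = orb z" using that orb_eq by auto
    then show False using that by simp
  qed
  have split: "card {x \<in> X. f x = x} = (\<Sum>A\<in>?Ac. card {y \<in> A. f y = y})"
    if f: "\<And>x. x \<in> X \<Longrightarrow> f x = x \<Longrightarrow> c ` orb x = orb x" for f
  proof -
    have "{x \<in> X. f x = x} = (\<Union>A\<in>?Ac. {y \<in> A. f y = y})"
      using self_in_orb orb_subset f by fastforce
    also have "card \<dots> = (\<Sum>A\<in>?Ac. card {y \<in> A. f y = y})"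
    proof (rule card_UN_disjoint[OF fin])
      show "\<forall>A\<in>?Ac. finite {y \<in> A. f y = y}"
        using finite_X orb_subset by (auto intro: finite_subset)
      show "\<forall>A\<in>?Ac. \<forall>B\<in>?Ac. A \<noteq> B \<longrightarrow> {y \<in> A. f y = y} \<inter> {y \<in> B. f y = y} = {}"
        using disj by blast
    qed
    finally show ?thesis .
  qed
  have "card {x \<in> X. c x = x} + card {x \<in> X. c (r x) = x}
      = (\<Sum>A\<in>?Ac. card {y \<in> A. c y = y} + card {y \<in> A. c (r y) = y})"
  proof -
    have "c ` orb x = orb x" if x: "x \<in> X" "c (r x) = x" for x
    proof -
      have "c x = r x" using x c_invol r_closed by metis
      moreover have "r x \<in> orb x" unfolding orb_def by (force intro!: exI[of _ 1])
      ultimately show ?thesis using c_image_orb[OF x(1)] orb_eq[OF x(1)] by simp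
    qed
    then show ?thesis using split[of c] split[of "\<lambda>x. c (r x)"] c_image_orb by (simp add: sum.distrib)
  qed
  also have "\<dots> = (\<Sum>A\<in>?Ac. 2)"
    by (rule sum.cong) (use card_fixed_orb in auto)
  finally show ?thesis by simp
qed

text \<open>For \<open>n = 2 * j + 1\<close>, the power \<open>r ^^ (j + 1)\<close> maps the fixed
  points of \<open>c\<close> after \<open>r\<close> injectively to those of \<open>c\<close>, and
  \<open>r ^^ j\<close> maps injectively the other way, which gives both inequalities.\<close>

lemma card_fixed_odd:
  assumes "odd n"
  shows "card {x \<in> X. c (r x) = x} = card {x \<in> X. c x = x}"
proof -
  obtain j where j: "n = 2 * j + 1" using assms by (elim oddE)
  have inj: "inj_on (r ^^ i) {x \<in> X. P x}" for i P using rpow_inject by (auto intro: inj_onI)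
  have "(r ^^ (j + 1)) x \<in> {x \<in> X. c x = x}" if x: "x \<in> X" "c (r x) = x" for x
  proof -
    have cx: "c x = r x" using x c_invol r_closed by metis
    have "(r ^^ (j + 1)) (c ((r ^^ (j + 1)) x)) = (r ^^ n) (r x)"
      unfolding rpow_c_rpow[OF x(1)] cx using r_cyclic r_closed x by simp
    also have "\<dots> = (r ^^ (n + 1)) x" by (simp add: funpow_swap1)
    also have "\<dots> = (r ^^ ((j + 1) + (j + 1))) x" by (simp add: j mult_2)
    also have "\<dots> = (r ^^ (j + 1)) ((r ^^ (j + 1)) x)" by (simp only: funpow_add comp_apply)
    finally have "c ((r ^^ (j + 1)) x) = (r ^^ (j + 1)) x"
      using rpow_inject rpow_closed c_closed x(1) by blast
    then show ?thesis using rpow_closed x(1) by blast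
  qed
  then have le1: "card {x \<in> X. c (r x) = x} \<le> card {x \<in> X. c x = x}"
    by (intro card_inj_on_le[OF inj[of "j + 1"]]) (use finite_X in auto)
  have "(r ^^ j) x \<in> {x \<in> X. c (r x) = x}" if x: "x \<in> X" "c x = x" for x
  proof -
    have "(r ^^ (j + 1)) (c ((r ^^ (j + 1)) x)) = (r ^^ n) x"
      unfolding rpow_c_rpow[OF x(1)] using r_cyclic x by simp
    also have "\<dots> = (r ^^ ((j + 1) + j)) x" by (simp add: j mult_2)
    also have "\<dots> = (r ^^ (j + 1)) ((r ^^ j) x)" by (simp only: funpow_add comp_apply)
    finally have "c ((r ^^ (j + 1)) x) = (r ^^ j) x"
      using rpow_inject rpow_closed c_closed x(1) by blast
    then show ?thesis using rpow_closed x(1) by simp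
  qed
  then have "card {x \<in> X. c x = x} \<le> card {x \<in> X. c (r x) = x}"
    by (intro card_inj_on_le[OF inj[of j]]) (use finite_X in auto)
  then show ?thesis using le1 by simp
qed

end

section \<open>Noncrossing partitions under rotation and complement\<close>

lemma partition_on_image:
  assumes P: "partition_on A P" and f: "inj_on f A"
  shows "partition_on (f ` A) ((`) f ` P)"
proof -
  have "{} \<notin> (`) f ` P" using P by (auto simp: partition_on_def)
  then show ?thesis using partition_on_inj_image[OF P f] by simp
qed

lemma inj_on_mirror: "inj_on (\<lambda>i. n + 1 - i) {1..n :: nat}"
  by (auto simp: inj_on_def)

lemma image_mirror: "(\<lambda>i. n + 1 - i) ` {1..n :: nat} = {1..n}"
  using endo_inj_surj[OF _ _ inj_on_mirror] mirror_subset[of "{1..n}" n] by (simp add: mirror_def)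

lemma NC_blocks_subset: "P \<in> NC n \<Longrightarrow> B \<in> P \<Longrightarrow> B \<subseteq> {1..n}"
  using NC_block by blast

text \<open>Reflection reverses the order, so a crossing comes from a crossing with the roles of the
  two blocks exchanged.\<close>

lemma complement_NC:
  assumes P: "P \<in> NC n" shows "complement n P \<in> NC n"
proof -
  have part: "partition_on {1..n} P" and nc: "\<not> crossing P" using P by (auto simp: NC_def)
  have "partition_on {1..n} (complement n P)"
    using partition_on_image[OF part inj_on_mirror] unfolding image_mirror complement_def .
  moreover have "\<not> crossing (complement n P)"
  proof
    assume "crossing (complement n P)"
    then obtain A B a b c d where h: "A \<in> P" "B \<in> P" "mirror n A \<noteq> mirror n B" "a < b" "b < c" "c < d"
      "a \<in> mirror n A" "c \<in> mirror n A" "b \<in> mirror n B" "d \<in> mirror n B"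
      unfolding complement_eq_mirror by (elim crossingE) blast
    have sub: "A \<subseteq> {1..n}" "B \<subseteq> {1..n}" using NC_blocks_subset P h by auto
    have rng: "a \<in> {1..n}" "b \<in> {1..n}" "c \<in> {1..n}" "d \<in> {1..n}"
      using h sub mirror_subset by blast+
    have mem: "n + 1 - a \<in> A" "n + 1 - c \<in> A" "n + 1 - b \<in> B" "n + 1 - d \<in> B"
      using h sub rng mem_mirror_iff by blast+
    have lt: "n + 1 - d < n + 1 - c" "n + 1 - c < n + 1 - b" "n + 1 - b < n + 1 - a"
      using h rng by auto
    have "B \<noteq> A" using h by auto
    then show False using crossingI[OF h(2,1) _ lt mem(4,3,2,1)] nc by blast
  qed
  ultimately show ?thesis by (simp add: NC_def)
qed

lemma inj_on_rotate: "inj_on (\<lambda>i. i mod n + 1) {1..n :: nat}"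
proof (rule inj_onI)
  fix x y assume "x \<in> {1..n}" "y \<in> {1..n}" "x mod n + 1 = y mod n + 1"
  then show "x = y" by (cases "x = n"; cases "y = n") auto
qed

lemma image_rotate: "(\<lambda>i. i mod n + 1) ` {1..n :: nat} = {1..n}"
proof -
  have "(\<lambda>i. i mod n + 1) ` {1..n} \<subseteq> {1..n}"
  proof
    fix y assume "y \<in> (\<lambda>i. i mod n + 1) ` {1..n}"
    then obtain i where "y = i mod n + 1" "i \<in> {1..n}" by auto
    then show "y \<in> {1..n}" using mod_less_divisor[of n i] by (simp, linarith)
  qed
  then show ?thesis using endo_inj_surj inj_on_rotate by blast
qed

text \<open>Rotation preserves the order except that \<open>n\<close> moves to the front. In a
  crossing of the image only the first point can come from \<open>n\<close>; putting it last again
  gives a crossing with the blocks exchanged.\<close>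

lemma rotation_NC:
  assumes P: "P \<in> NC n" shows "rotation n P \<in> NC n"
proof -
  let ?r = "\<lambda>i. i mod n + 1"
  have part: "partition_on {1..n} P" and nc: "\<not> crossing P" using P by (auto simp: NC_def)
  have "partition_on {1..n} (rotation n P)"
    using partition_on_image[OF part inj_on_rotate] unfolding image_rotate rotation_def .
  moreover have "\<not> crossing (rotation n P)"
  proof
    assume "crossing (rotation n P)"
    then obtain A B a b c d where h: "A \<in> P" "B \<in> P" "?r ` A \<noteq> ?r ` B"
      "?r a < ?r b" "?r b < ?r c" "?r c < ?r d" and mem: "a \<in> A" "c \<in> A" "b \<in> B" "d \<in> B"
      unfolding rotation_def by (elim crossingE) blast
    have AB: "A \<noteq> B" using h by auto
    have rng: "a \<in> {1..n}" "b \<in> {1..n}" "c \<in> {1..n}" "d \<in> {1..n}"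
      using NC_blocks_subset[OF P] h mem by blast+
    have r: "?r x = (if x = n then 1 else x + 1)" if "x \<in> {1..n}" for x using that by auto
    have lt: "b < c" "c < d" "d \<le> n" "b < n" "c < n" "d < n"
      using h(4-6) rng unfolding rng[THEN r] by (auto split: if_splits)
    show False
    proof (cases "a = n")
      case True
      then show False using crossingI[OF h(2,1) AB[symmetric] lt(1,2) _ mem(3,4,2,1)] nc lt(6) by blast
    next
      case False
      then have "a < b" using h(4) rng lt unfolding rng[THEN r] by (auto split: if_splits)
      then show False using crossingI[OF h(1,2) AB _ lt(1,2) mem] nc by blast
    qed
  qed
  ultimately show ?thesis by (simp add: NC_def)
qed

text \<open>Reduces identities between operators on partitions to identities between maps on
  points.\<close>

lemma image_blocks_id:
  assumes "P \<in> NC n" "\<And>x. x \<in> {1..n} \<Longrightarrow> f x = x"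
  shows "(`) f ` P = P"
proof -
  have "f ` B = B" if "B \<in> P" for B
  proof -
    have "f x = x" if "x \<in> B" for x using NC_blocks_subset[OF assms(1) \<open>B \<in> P\<close>] assms(2) that by blast
    then show ?thesis by simp
  qed
  then show ?thesis by simp
qed

lemma rotation_funpow: "(rotation n ^^ i) P = (`) ((\<lambda>i. i mod n + 1) ^^ i) ` P"
  by (induction i) (simp_all add: rotation_def image_image image_comp)

lemma rotate_funpow:
  assumes "x \<in> {1..n}"
  shows "((\<lambda>i. i mod n + 1) ^^ i) x = (x - 1 + i) mod n + 1"
proof (induction i)
  case 0
  have "x - 1 < n" using assms by auto
  then show ?case using assms by simp
next
  case (Suc i)
  then show ?case by (simp add: mod_Suc_eq)
qed

lemma dihedral_action_NC:
  assumes n: "n \<ge> 1"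
  shows "dihedral_action (NC n) (rotation n) (complement n) n"
proof
  fix P assume P: "P \<in> NC n"
  show "(rotation n ^^ n) P = P"
    unfolding rotation_funpow
  proof (rule image_blocks_id[OF P])
    fix x assume x: "x \<in> {1..n}"
    then have shift: "(x - 1 + n) mod n = x - 1" by (subst mod_add_self2) auto
    then show "((\<lambda>i. i mod n + 1) ^^ n) x = x" unfolding rotate_funpow[OF x] shift using x by simp
  qed
  have "complement n (complement n P) = (`) (\<lambda>i. n + 1 - (n + 1 - i)) ` P"
    by (simp add: complement_def image_image)
  also have "\<dots> = P" by (rule image_blocks_id[OF P]) auto
  finally show "complement n (complement n P) = P" .
  \<comment> \<open>On points, complement after rotation sends \<open>i\<close> to
    \<open>n - i\<close> for \<open>i < n\<close> and fixes \<open>n\<close>, hence is an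
    involution.\<close>
  have "complement n (rotation n (complement n (rotation n P)))
      = (`) (\<lambda>i. n + 1 - ((n + 1 - (i mod n + 1)) mod n + 1)) ` P"
    by (simp add: complement_def rotation_def image_image)
  also have "\<dots> = P"
  proof (rule image_blocks_id[OF P])
    fix x assume x: "x \<in> {1..n}"
    show "n + 1 - ((n + 1 - (x mod n + 1)) mod n + 1) = x"
      using x by (cases "x = n") auto
  qed
  finally show "complement n (rotation n (complement n (rotation n P))) = P" .
qed (use n finite_NC rotation_NC complement_NC in auto)

section \<open>Partitions fixed by complement after rotation for even n\<close>

text \<open>Among the blocks equal to their mirror image, one of which contains the middle point,
  let \<open>A\<close> be the one with the leftmost point \<open>a\<close>. It spans from
  \<open>a\<close> to \<open>n + 1 - a\<close>; any other such block lies beneath this arc, and a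
  block covering a point of \<open>A\<close> would cross either \<open>A\<close> or its own mirror
  image.\<close>

lemma unique_self_complementary_outer:
  assumes R: "R \<in> self_complementary_NC n" and n: "odd n"
  shows "\<exists>!A. A \<in> outer R \<and> mirror n A = A"
proof -
  have RN: "R \<in> NC n" and part: "partition_on {1..n} R" and nc: "\<not> crossing R" and cR: "mirror n ` R = R"
    using R by (auto simp: self_complementary_NC_def NC_def complement_eq_mirror)
  note sub = NC_blocks_subset[OF RN]
  have mem: "n + 1 - x \<in> mirror n B" if "x \<in> B" for x B using that by (auto simp: mirror_def)
  have eq: "A = B" if "A \<in> R" "B \<in> R" "x \<in> A" "x \<in> B" for A B x
    using partition_on_blocks_eq[OF part that] .
  define S where "S = {x \<in> half n. \<exists>B\<in>R. x \<in> B \<and> mirror n B = B}"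
  have finS: "finite S" by (simp add: S_def half_def)
  have "S \<noteq> {}"
  proof -
    obtain k where k: "n = 2 * k + 1" using n by (elim oddE)
    have "k + 1 \<in> \<Union>R" using part k by (auto simp: partition_on_def)
    then obtain B where B: "B \<in> R" "k + 1 \<in> B" by blast
    have "k + 1 \<in> half n" using k by (simp add: half_def)
    moreover have "mirror n B = B"
      by (rule self_complementary_block[OF R B]) (use k in \<open>auto simp: half_def\<close>)
    ultimately show ?thesis using B unfolding S_def by blast
  qed
  define a where "a = Min S"
  have "a \<in> S" using finS \<open>S \<noteq> {}\<close> by (simp add: a_def)
  then obtain A where A: "A \<in> R" "a \<in> A" "mirror n A = A" and ah: "a \<in> half n" by (auto simp: S_def)
  have amin: "a \<le> x" if "B \<in> R" "mirror n B = B" "x \<in> B" for x B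
  proof (cases "x \<in> half n")
    case True
    then have "x \<in> S" using that by (auto simp: S_def)
    then show ?thesis using finS by (simp add: a_def)
  next
    case False
    have "x \<in> {1..n}" using sub that by blast
    then show ?thesis using False ah by (auto simp: half_def)
  qed
  have a': "n + 1 - a \<in> A" using mem[OF A(2)] A(3) by simp
  have an: "a \<in> {1..n}" using sub A by blast
  have "D = A" if D: "D \<in> R" and xy: "x \<in> D" "y \<in> D" and b: "b \<in> A" "x < b" "b < y" for D x y b
  proof (rule ccontr)
    assume ne: "D \<noteq> A"
    have rng: "x \<in> {1..n}" "y \<in> {1..n}" "b \<in> {1..n}" using sub D A(1) xy b by blast+
    have bA: "a \<le> b" "b \<le> n + 1 - a"
    proof -
      show "a \<le> b" using amin A(1,3) b by blast
      have "a \<le> n + 1 - b" using amin A(1,3) mem[OF b(1)] by auto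
      then show "b \<le> n + 1 - a" using rng by auto
    qed
    have xa: "x \<noteq> a" "y \<noteq> n + 1 - a" using eq[OF D A(1)] xy A(2) a' ne by auto
    have "\<not> a < x" using crossingI[OF A(1) D ne[symmetric] _ b(2,3) A(2) b(1) xy] nc by blast
    then have x: "x < a" using xa by simp
    have "\<not> y < n + 1 - a" using crossingI[OF D A(1) ne b(2,3) _ xy b(1) a'] nc by blast
    then have y: "n + 1 - a < y" using xa by simp
    \<comment> \<open>The block \<open>D\<close> reaches to the left of \<open>a\<close>, so by
      minimality it differs from its mirror image \<open>E\<close>; both pass over the centre, hence
      they cross.\<close>
    define E where "E = mirror n D"
    have E: "E \<in> R" "n + 1 - y \<in> E" "n + 1 - x \<in> E" using cR D mem xy by (auto simp: E_def)
    have "E \<noteq> D" using amin[OF D _ xy(1)] x by (auto simp: E_def)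
    then have nxy: "n + 1 - y \<noteq> x" using eq[OF E(1) D E(2)] xy by auto
    have bounds: "n + 1 - y < y" "x < n + 1 - x" using ah x y rng by (auto simp: half_def)
    show False
    proof (cases "x < n + 1 - y")
      case True
      then have "y < n + 1 - x" using rng by auto
      then show False
        using crossingI[OF D E(1) \<open>E \<noteq> D\<close>[symmetric] True bounds(1) _ xy E(2,3)] nc by blast
    next
      case False
      then have "n + 1 - y < x" "n + 1 - x < y" using nxy rng by auto
      then show False
        using crossingI[OF E(1) D \<open>E \<noteq> D\<close> _ bounds(2) _ E(2,3) xy] nc by blast
    qed
  qed
  then have "A \<in> outer R" unfolding outer_def using A(1) by blast
  moreover have "B = A" if B: "B \<in> outer R" "mirror n B = B" for B
  proof (rule ccontr)
    assume ne: "B \<noteq> A"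
    have BR: "B \<in> R" using B by (simp add: outer_def)
    then obtain b where b: "b \<in> B" using part by (metis all_not_in_conv partition_on_def)
    have b': "n + 1 - b \<in> B" using mem[OF b] B by simp
    have "b \<in> {1..n}" using sub BR b by blast
    moreover have "a \<le> b" "a \<le> n + 1 - b" using amin[OF BR B(2)] b b' by auto
    moreover have "b \<noteq> a" "b \<noteq> n + 1 - a" using eq[OF BR A(1)] b A(2) a' ne by auto
    ultimately have "a < b" "b < n + 1 - a" using an by auto
    then show False using outerD[OF B(1) A(1,2) a' b] ne by simp
  qed
  ultimately show ?thesis using A(3) by blast
qed

text \<open>Complement after rotation fixes the last point and acts on the remaining
  \<open>m\<close> points as their own complement.\<close>

lemma complement_rotation_ins:
  assumes Q: "Q \<in> NC m" and B: "B \<in> insert {} Q"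
  shows "complement (Suc m) (rotation (Suc m) (ins (Suc m) B Q))
    = ins (Suc m) (mirror m B) (mirror m ` Q)"
proof -
  define f where "f = (\<lambda>i. Suc m + 1 - (i mod Suc m + 1))"
  have CR: "complement (Suc m) (rotation (Suc m) P) = (`) f ` P" for P
    by (simp add: complement_def rotation_def image_image f_def)
  have f: "f ` A = mirror m A" if "A \<subseteq> {1..m}" for A
    unfolding mirror_def by (rule image_cong) (use that in \<open>auto simp: f_def\<close>)
  have sub: "A \<subseteq> {1..m}" if "A \<in> insert B Q" for A
    using NC_blocks_subset[OF Q] that B by auto
  have "(`) f ` (Q - {B}) = mirror m ` (Q - {B})"
    by (rule image_cong) (use f sub in auto)
  also have "\<dots> = mirror m ` Q - {mirror m B}"
  proof -
    have "mirror m A = mirror m B \<longleftrightarrow> A = B" if "A \<in> Q" for A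
      using mirror_eq_iff sub that by simp
    then show ?thesis by blast
  qed
  finally have "(`) f ` (Q - {B}) = mirror m ` Q - {mirror m B}" .
  moreover have "f (Suc m) = Suc m" by (simp add: f_def)
  moreover have "f ` B = mirror m B" using f sub by blast
  ultimately show ?thesis unfolding CR by (simp add: ins_def)
qed

text \<open>With \<open>m = n - 1\<close> odd, a fixed partition is a self-complementary partition
  of \<open>m\<close> points together with a self-mirrored choice of \<open>B\<close>: either
  \<open>{}\<close> or the block from \<open>unique_self_complementary_outer\<close>.\<close>

lemma card_reflection_fixed_even:
  assumes n: "even n" "n \<ge> 1"
  shows "card {P \<in> NC n. complement n (rotation n P) = P} = n choose (n div 2)"
proof -
  obtain k where k: "n = 2 * Suc k" using n by (metis evenE mult_0_right not_one_le_zero old.nat.exhaust)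
  define m where "m = 2 * k + 1"
  have nm: "n = Suc m" by (simp add: m_def k)
  define G where "G = (SIGMA Q:self_complementary_NC m. {B \<in> insert {} (outer Q). mirror m B = B})"
  have oQ: "outer Q \<subseteq> Q" for Q by (auto simp: outer_def)
  let ?f = "\<lambda>(Q, B). ins (Suc m) B Q"
  have fix_iff: "complement n (rotation n (ins (Suc m) B Q)) = ins (Suc m) B Q
      \<longleftrightarrow> mirror m ` Q = Q \<and> mirror m B = B" if Q: "Q \<in> NC m" and B: "B \<in> insert {} (outer Q)" for Q B
  proof -
    have part: "partition_on {1..m} Q" "partition_on {1..m} (mirror m ` Q)"
      using Q complement_NC[OF Q] unfolding complement_eq_mirror by (auto simp: NC_def)
    have B': "B \<in> insert {} Q" "mirror m B \<in> insert {} (mirror m ` Q)"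
      using B oQ by (auto simp: mirror_def)
    show ?thesis
      unfolding nm complement_rotation_ins[OF Q B'(1)]
      using ins_inject[OF part(2,1) _ B'(2,1), of "Suc m"] by fastforce
  qed
  have "{P \<in> NC n. complement n (rotation n P) = P} = ?f ` G"
  proof (intro equalityI subsetI)
    fix P assume P: "P \<in> {P \<in> NC n. complement n (rotation n P) = P}"
    then have "P \<in> ?f ` (SIGMA Q:NC m. insert {} (outer Q))"
      using bij_betw_imp_surj_on[OF NC_Suc_bij[of m]] nm by simp
    then obtain Q B where QB: "Q \<in> NC m" "B \<in> insert {} (outer Q)" "P = ins (Suc m) B Q" by blast
    then have "(Q, B) \<in> G" using fix_iff[OF QB(1,2)] P
      by (simp add: G_def self_complementary_NC_def complement_eq_mirror)
    then show "P \<in> ?f ` G" using QB by force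
  next
    fix P assume "P \<in> ?f ` G"
    then obtain Q B where QB: "Q \<in> NC m" "B \<in> insert {} (outer Q)" "P = ins (Suc m) B Q"
      "mirror m ` Q = Q" "mirror m B = B"
      by (auto simp: G_def self_complementary_NC_def complement_eq_mirror)
    have "P \<in> NC (Suc m)" using bij_betw_imp_surj_on[OF NC_Suc_bij[of m]] QB by blast
    then show "P \<in> {P \<in> NC n. complement n (rotation n P) = P}"
      using fix_iff[OF QB(1,2)] QB nm by simp
  qed
  moreover have "inj_on ?f G"
    by (rule inj_on_subset[OF bij_betw_imp_inj_on[OF NC_Suc_bij[of m]]])
       (auto simp: G_def self_complementary_NC_def)
  ultimately have "card {P \<in> NC n. complement n (rotation n P) = P} = card G"
    by (simp add: card_image)
  also have "\<dots> = 2 * card (self_complementary_NC m)"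
  proof -
    have "card {B \<in> insert {} (outer Q). mirror m B = B} = 2 \<and>
        finite {B \<in> insert {} (outer Q). mirror m B = B}" if Q: "Q \<in> self_complementary_NC m" for Q
    proof -
      obtain A where A: "{B \<in> outer Q. mirror m B = B} = {A}"
        using unique_self_complementary_outer[OF Q] by (auto simp: m_def)
      then have "{B \<in> insert {} (outer Q). mirror m B = B} = {{}, A}" by (auto simp: mirror_def)
      moreover have "A \<in> outer Q" using A by (metis (mono_tags, lifting) mem_Collect_eq singletonI)
      then have "A \<in> Q" by (rule subsetD[OF oQ])
      moreover have "Q \<in> NC m" using Q by (simp add: self_complementary_NC_def)
      ultimately show ?thesis using NC_block[of Q m A] by (auto simp: card_insert_if)
    qed
    moreover have "finite (self_complementary_NC m)"
      using finite_NC by (simp add: self_complementary_NC_def)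
    ultimately show ?thesis unfolding G_def by simp
  qed
  also have "\<dots> = 2 * ((2 * k + 1) choose k)"
    unfolding card_self_complementary_NC by (simp add: m_def)
  also have "\<dots> = n choose (n div 2)"
    using binomial_symmetric[of k "2 * k + 1"] by (simp add: k)
  finally show ?thesis .
qed

theorem theorem2:
  fixes n :: nat
  assumes "n \<ge> 1"
  shows "achiral_NC_classes n \<approx> self_complementary_NC n \<and>
         card (achiral_NC_classes n) = n choose (n div 2)"
proof -
  interpret dihedral_action "NC n" "rotation n" "complement n" n
    by (rule dihedral_action_NC[OF assms])
  have "rotation_class n P = orb P" for P
    by (simp add: rotation_class_def orb_def)
  then have classes: "achiral_NC_classes n = {A \<in> orb ` NC n. complement n ` A = A}"
    by (simp add: achiral_NC_classes_def NC_rotation_classes_def)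
  have sc: "self_complementary_NC n = {P \<in> NC n. complement n P = P}"
    by (simp add: self_complementary_NC_def)
  have "card {P \<in> NC n. complement n (rotation n P) = P} = n choose (n div 2)"
  proof (cases "even n")
    case False
    then show ?thesis using card_fixed_odd card_self_complementary_NC[of n] unfolding sc by simp
  qed (use card_reflection_fixed_even assms in blast)
  \<comment> \<open>Both fixed-point counts equal the binomial coefficient, so the factor 2 of
    \<open>card_achiral_orbits\<close> cancels.\<close>
  then have card: "card (achiral_NC_classes n) = n choose (n div 2)"
    using card_achiral_orbits card_self_complementary_NC[of n] unfolding classes sc by simp
  moreover have "finite (achiral_NC_classes n)" "finite (self_complementary_NC n)"
    unfolding classes sc using finite_NC by simp_all
  ultimately show ?thesis
    using eqpoll_iff_card card_self_complementary_NC[of n] by metis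
qed

end
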